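(* Let $p$ be a prime number, $n\in\mathbb{Z}^+$ and $\gamma\in\mathbb{Z}$ such that $|\gamma|<n$ and $p\mid n-\gamma$. Suppose that there exists a $p$-ary nearly perfect sequence of type $\gamma$ and period $n$. Then the following hold. (i) Suppose $\gamma=0$. Let $q\ne p$ be a prime number dividing $n$ such that $q^r\,\|\,n$ and $q$ is self-conjugate modulo $up$ for some divisor $u\ge 1$ of $n$. Then $r$ is even and $q^{r/2}\le \frac{n}{u}$. (ii) Suppose $\gamma\ne 0$. Let $q\ne p$ be a prime number dividing $n-\gamma$ such that $q^r\,\|\,n-\gamma$ and $q$ is self-conjugate modulo $up$ for some divisor $u>1$ of $n$. If $q\nmid u$, then $r$ is even and $q^{r/2}\le\frac{n}{u}$. If $q\mid u$, then $q^{\lfloor r/2\rfloor}\le 2\frac{n}{u}$. (iii) Suppose $\gamma\ne 0$. If $p^r\,\|\,n-\gamma$ and $p$ is self-conjugate modulo $u$ for some divisor $u>1$ of $n$ such that $p\nmid u$, then $p^{r/2}\le 2\frac{n}{u}$ in case $r$ is even, and $p^{(r+1)/2}\le 4\frac{n}{u}$ in case $r$ is odd. (iv) Suppose $\gamma\ne 0$. Let $q\ne p$ be a prime number dividing $(\gamma+1)n-\gamma$ such that $q^r\,\|\,(\gamma+1)n-\gamma$ and $q$ is self-conjugate modulo $up$ for some divisor $u\ge 1$ of $n$. If $q\nmid u$, then $r$ is even.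
   Context: A $p$-ary sequence of period $n$ is a sequence $\underline{a}=(a_0,a_1,\ldots)$ of complex numbers of period $n$ (so $a_{i+n}=a_i$) all of whose entries are of the form $a_i=\zeta_p^{b_i}$ with $b_i$ an integer, where $\zeta_p\in\mathbb{C}$ is a primitive $p$-th root of unity. Its autocorrelation function is $C_{\underline{a}}(t)=\sum_{i=0}^{n-1}a_i\overline{a_{i+t}}$ for $0\le t\le n-1$. The sequence is a nearly perfect sequence (NPS) of type $\gamma$ if $C_{\underline{a}}(t)=\gamma$ for all $1\le t\le n-1$. For a prime $q$ and an integer $v\ge 1$ written as $v=q^e w$ with $\gcd(q,w)=1$, $q$ is called self-conjugate modulo $v$ if $q^j\equiv -1 \pmod w$ for some integer $j$. The notation $q^r\,\|\,N$ means $q^r\mid N$ and $q^{r+1}\nmid N$. *)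

theory Defs
  imports "HOL-Analysis.Analysis" "HOL-Number_Theory.Number_Theory"
begin

definition primitive_root_of_unity :: "nat \<Rightarrow> complex \<Rightarrow> bool" where
  "primitive_root_of_unity m z \<longleftrightarrow> m > 0 \<and> z ^ m = 1 \<and> (\<forall>k. 0 < k \<and> k < m \<longrightarrow> z ^ k \<noteq> 1)"

(* The period n need not be the least period. *)
definition p_ary_sequence :: "nat \<Rightarrow> nat \<Rightarrow> (nat \<Rightarrow> complex) \<Rightarrow> bool" where
  "p_ary_sequence p n a \<longleftrightarrow>
     (\<forall>i. a (i + n) = a i) \<and>
     (\<exists>\<zeta>. primitive_root_of_unity p \<zeta> \<and> (\<forall>i. \<exists>b::int. a i = \<zeta> powi b))"

definition autocorrelation :: "nat \<Rightarrow> (nat \<Rightarrow> complex) \<Rightarrow> nat \<Rightarrow> complex" where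
  "autocorrelation n a t = (\<Sum>i<n. a i * cnj (a (i + t)))"

definition nearly_perfect_sequence ::
    "nat \<Rightarrow> nat \<Rightarrow> int \<Rightarrow> (nat \<Rightarrow> complex) \<Rightarrow> bool" where
  "nearly_perfect_sequence p n \<gamma> a \<longleftrightarrow>
     p_ary_sequence p n a \<and>
     (\<forall>t. 1 \<le> t \<and> t \<le> n - 1 \<longrightarrow> autocorrelation n a t = of_int \<gamma>)"

(* For q prime and v > 0 the decomposition v = q^e * w is unique.  Natural exponents j
   suffice: modulo w, the inverse of q^j is -1 exactly when q^j is. *)
definition self_conjugate_mod :: "nat \<Rightarrow> nat \<Rightarrow> bool" where
  "self_conjugate_mod q v \<longleftrightarrow>
     (\<exists>e w j. v = q ^ e * w \<and> coprime q w \<and> [int q ^ j = -1] (mod int w))"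

definition exact_power_dvd :: "nat \<Rightarrow> nat \<Rightarrow> int \<Rightarrow> bool" where
  "exact_power_dvd q r N \<longleftrightarrow> int q ^ r dvd N \<and> \<not> int q ^ (r + 1) dvd N"

end

theory Submission
  imports Defs "Jordan_Normal_Form.Char_Poly"
begin

text \<open>
Let \<open>z\<close> be a primitive root of unity of order \<open>u p\<close> and \<open>x\<close> a \<open>u\<close>-th root of unity. The character
  sum \<open>X = (\<Sum>i<n. a i * x ^ i)\<close> lies in \<open>\<int>[z]\<close>, and the autocorrelation condition says that
  \<open>X * cnj X\<close> is \<open>n - \<gamma>\<close> for \<open>x \<noteq> 1\<close> and \<open>(\<gamma> + 1) n - \<gamma>\<close> for \<open>x = 1\<close> (\<open>character_norm\<close>).

  If \<open>q\<close> is self-conjugate modulo \<open>u p\<close>, which for \<open>q = p\<close> not dividing \<open>u\<close> means the same as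
  self-conjugate modulo \<open>u\<close>, complex conjugation fixes every prime ideal above \<open>q\<close>, so such
  an ideal divides \<open>X\<close> exactly half as often as it divides \<open>X * cnj X\<close>. No ideals are needed to exploit
  this. Take \<open>\<pi> = q\<close> if \<open>q\<close> is coprime to the order of the root, and \<open>\<pi> = 1 - \<alpha>\<close> with \<open>\<alpha>\<close> a primitive
  root of order the \<open>q\<close>-part of it otherwise. The Frobenius congruence turns self-conjugacy into
  \<open>y ^ Q \<equiv> cnj y\<close> modulo \<open>\<pi>\<close> for a power \<open>Q\<close> of \<open>q\<close>; hence \<open>\<pi>\<close> divides \<open>X\<close> as soon as it divides
  \<open>X * cnj X\<close>, and one can divide by \<open>\<pi>\<close> and repeat (\<open>half_valuation\<close>). In the unramified case this
  forces \<open>r\<close> to be even, which settles all the parity claims; the sum for \<open>x = 1\<close> lies in the subring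
  generated by the \<open>p\<close>-th roots of unity, in which every \<open>q \<noteq> p\<close> is unramified.

  For the size bounds write \<open>X = (\<Sum>k<u. B k * x ^ k)\<close>, where \<open>B k\<close> adds up the entries whose index is
  congruent to \<open>k\<close> modulo \<open>u\<close>. Fourier inversion transfers the divisibility of the sums \<open>X\<close> for
  \<open>x \<noteq> 1\<close> to differences \<open>B k - B (k + s)\<close>, which do not all vanish because \<open>X \<noteq> 0\<close>. If \<open>q\<close> divides
  \<open>u\<close>, inversion over the \<open>q\<close>-part would lose a power of \<open>q\<close>; there it is replaced by the fact that the
  powers of \<open>\<alpha>\<close> behave like a basis also modulo \<open>q\<close> (\<open>coefficient_differences_dvd\<close>).

  Finally \<open>B k = (\<Sum>j<p. b k j * \<zeta> ^ j)\<close> with \<open>\<zeta>\<close> a primitive \<open>p\<close>-th root of unity and counts \<open>b k j\<close>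
  that sum to \<open>m = n div u\<close>, so everything becomes a question about the integers
  \<open>d j = b k j - b (k + s) j\<close>, which sum to \<open>0\<close> and have absolute value at most \<open>m\<close>. For \<open>q \<noteq> p\<close> each
  \<open>d j\<close> is divisible by \<open>q ^ (r div 2)\<close> and some \<open>d j\<close> is not \<open>0\<close>, so this power is at most \<open>m\<close>. For
  \<open>q = p\<close> only the differences \<open>d i - d j\<close> are divisible, which gives \<open>2 * m\<close>. If moreover \<open>r = 2 t + 1\<close>, then \<open>p\<close> is odd,
  the \<open>d j\<close> are congruent modulo \<open>p ^ t\<close> and there is an additional factor \<open>(1 - \<zeta>) ^ ((p - 1) div 2)\<close>.
  A nonzero polynomial of degree below \<open>p\<close> over the field with \<open>p\<close> elements that vanishes to order \<open>s\<close> at \<open>1\<close>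
  has more than \<open>s\<close> nonzero coefficients, so either all \<open>d j\<close> agree modulo \<open>p ^ (t + 1)\<close>, or no value is
  taken by more than half of the \<open>d j\<close>. In the second case \<open>(\<Sum>j<p. \<bar>d j\<bar>)\<close> is too large unless
  \<open>p ^ (t + 1) \<le> 4 * m\<close>.
\<close>

section \<open>The rings \<open>\<int>[z]\<close>\<close>

text \<open>The subring \<open>\<int>[z]\<close> of the complex numbers. For a root of unity \<open>z\<close> of order \<open>v\<close> it is the ring of
  integers of the \<open>v\<close>-th cyclotomic field.\<close>
definition int_adjoin :: "complex \<Rightarrow> complex set" where
  "int_adjoin z = range (\<lambda>f :: int poly. poly (of_int_poly f) z)"

lemma int_adjoin_of_int [simp, intro]: "of_int k \<in> int_adjoin z"
  unfolding int_adjoin_def by (rule range_eqI [of _ _ "[:k:]"]) (cases "k = 0", simp_all add: of_int_hom.map_poly_pCons_hom)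

lemma int_adjoin_0 [simp, intro]: "0 \<in> int_adjoin z"
  using int_adjoin_of_int [of 0 z] by simp

lemma int_adjoin_1 [simp, intro]: "1 \<in> int_adjoin z"
  using int_adjoin_of_int [of 1 z] by simp

lemma int_adjoin_of_nat [simp, intro]: "of_nat k \<in> int_adjoin z"
  using int_adjoin_of_int [of "int k" z] by simp

lemma int_adjoin_generator [simp, intro]: "z \<in> int_adjoin z"
  unfolding int_adjoin_def by (rule range_eqI [of _ _ "[:0, 1:]"]) simp

lemma int_adjoin_add [intro]:
  assumes "x \<in> int_adjoin z" "y \<in> int_adjoin z"
  shows "x + y \<in> int_adjoin z"
proof -
  from assms obtain f g where "x = poly (of_int_poly f) z" "y = poly (of_int_poly g) z"
    unfolding int_adjoin_def by auto
  then have "x + y = poly (of_int_poly (f + g)) z" by (simp add: of_int_poly_hom.hom_add)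
  then show ?thesis unfolding int_adjoin_def by blast
qed

lemma int_adjoin_mult [intro]:
  assumes "x \<in> int_adjoin z" "y \<in> int_adjoin z"
  shows "x * y \<in> int_adjoin z"
proof -
  from assms obtain f g where "x = poly (of_int_poly f) z" "y = poly (of_int_poly g) z"
    unfolding int_adjoin_def by auto
  then have "x * y = poly (of_int_poly (f * g)) z" by (simp add: of_int_poly_hom.hom_mult)
  then show ?thesis unfolding int_adjoin_def by blast
qed

lemma int_adjoin_uminus [intro]: "x \<in> int_adjoin z \<Longrightarrow> - x \<in> int_adjoin z"
  using int_adjoin_mult [of "-1" z x] int_adjoin_of_int [of "-1" z] by simp

lemma int_adjoin_diff [intro]:
  "x \<in> int_adjoin z \<Longrightarrow> y \<in> int_adjoin z \<Longrightarrow> x - y \<in> int_adjoin z"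
  using int_adjoin_add [of x z "- y"] int_adjoin_uminus [of y z] by simp

lemma int_adjoin_power [intro]: "x \<in> int_adjoin z \<Longrightarrow> x ^ k \<in> int_adjoin z"
  by (induction k) auto

lemma int_adjoin_sum [intro]:
  "(\<And>i. i \<in> A \<Longrightarrow> f i \<in> int_adjoin z) \<Longrightarrow> sum f A \<in> int_adjoin z"
  by (induction A rule: infinite_finite_induct) auto

lemma int_adjoin_subset:
  assumes "y \<in> int_adjoin z"
  shows "int_adjoin y \<subseteq> int_adjoin z"
proof
  fix x assume "x \<in> int_adjoin y"
  then obtain f where "x = poly (of_int_poly f) y" unfolding int_adjoin_def by auto
  moreover have "poly (of_int_poly f) y \<in> int_adjoin z" for f :: "int poly"
    using assms by (induction f) (auto simp: of_int_hom.map_poly_pCons_hom)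
  ultimately show "x \<in> int_adjoin z" by simp
qed

text \<open>Conjugation preserves \<open>\<int>[z]\<close> because it maps \<open>z\<close> to its inverse \<open>z ^ (v - 1)\<close>.\<close>
lemma int_adjoin_cnj:
  assumes "z ^ v = 1" "v > 0" "cmod z = 1" "x \<in> int_adjoin z"
  shows "cnj x \<in> int_adjoin z"
proof -
  have "cnj z = z ^ (v - 1)"
  proof -
    have "z * cnj z = 1" using assms(3) by (metis complex_norm_square of_real_1 one_power2)
    moreover have "z * z ^ (v - 1) = 1" using assms by (metis power_eq_if neq0_conv)
    ultimately show ?thesis by (metis mult_cancel_left mult_zero_left zero_neq_one)
  qed
  then have c: "cnj z \<in> int_adjoin z" by auto
  obtain f where "x = poly (of_int_poly f) z" using assms(4) unfolding int_adjoin_def by auto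
  moreover have "cnj (poly (of_int_poly f) z) \<in> int_adjoin z" for f :: "int poly"
    using c by (induction f) (auto simp: of_int_hom.map_poly_pCons_hom)
  ultimately show ?thesis by simp
qed

text \<open>Exponents can be reduced modulo \<open>v\<close>, so \<open>\<int>[z]\<close> is a finitely generated additive group.\<close>
lemma int_adjoin_root_of_unity_sum:
  assumes "z ^ v = 1" "v > 0" "x \<in> int_adjoin z"
  obtains c :: "nat \<Rightarrow> int" where "x = (\<Sum>j<v. of_int (c j) * z ^ j)"
proof -
  obtain f where f: "x = poly (of_int_poly f) z" using assms(3) unfolding int_adjoin_def by auto
  have "\<exists>c :: nat \<Rightarrow> int. poly (of_int_poly f) z = (\<Sum>j<v. of_int (c j) * z ^ j)" for f :: "int poly"
  proof (induction f)
    case 0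
    show ?case by (rule exI [of _ "\<lambda>_. 0"]) simp
  next
    case (pCons a f)
    then obtain c :: "nat \<Rightarrow> int" where c: "poly (of_int_poly f) z = (\<Sum>j<v. of_int (c j) * z ^ j)" by blast
    obtain w where w: "v = Suc w" using assms(2) by (cases v) auto
    have "z * (\<Sum>j<v. of_int (c j) * z ^ j) = (\<Sum>j<w. of_int (c j) * z ^ Suc j) + of_int (c w) * z ^ v"
      by (simp add: w algebra_simps sum_distrib_left)
    also have "\<dots> = (\<Sum>j<v. of_int (case j of 0 \<Rightarrow> c w | Suc j \<Rightarrow> c j) * z ^ j)"
      unfolding w sum.lessThan_Suc_shift using assms(1) by (simp add: w del: power_Suc)
    finally have s: "z * (\<Sum>j<v. of_int (c j) * z ^ j) = \<dots>" .
    have a: "(of_int a :: complex) = (\<Sum>j<v. of_int (if j = 0 then a else 0) * z ^ j)"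
      unfolding w sum.lessThan_Suc_shift by simp
    have "poly (of_int_poly (pCons a f)) z = of_int a + z * (\<Sum>j<v. of_int (c j) * z ^ j)"
      by (simp add: c of_int_hom.map_poly_pCons_hom)
    also have "\<dots> = (\<Sum>j<v. of_int ((if j = 0 then a else 0) + (case j of 0 \<Rightarrow> c w | Suc j \<Rightarrow> c j)) * z ^ j)"
      unfolding s a sum.distrib [symmetric] by (intro sum.cong) (auto simp: algebra_simps)
    finally show ?case by (rule exI [of _ "\<lambda>j. (if j = 0 then a else 0) + (case j of 0 \<Rightarrow> c w | Suc j \<Rightarrow> c j)"])
  qed
  with f that show ?thesis by blast
qed

text \<open>Multiplication by \<open>x\<close> acts on the generators \<open>z ^ i\<close> by an integer matrix with eigenvalue \<open>x\<close>, and the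
  characteristic polynomial of that matrix is monic with integer coefficients.\<close>
lemma int_adjoin_root_of_unity_integral:
  assumes "z ^ v = 1" "v > 0" "x \<in> int_adjoin z"
  obtains f :: "int poly" where "lead_coeff f = 1" "degree f = v" "poly (of_int_poly f) x = 0"
proof -
  have "\<forall>i. \<exists>c :: nat \<Rightarrow> int. x * z ^ i = (\<Sum>j<v. of_int (c j) * z ^ j)"
    using int_adjoin_root_of_unity_sum [OF assms(1,2)] assms(3)
    by (metis int_adjoin_generator int_adjoin_mult int_adjoin_power)
  then obtain c :: "nat \<Rightarrow> nat \<Rightarrow> int" where c: "\<And>i. x * z ^ i = (\<Sum>j<v. of_int (c i j) * z ^ j)" by metis
  define A where "A = mat v v (\<lambda>(i, j). c i j)"
  define B :: "complex mat" where "B = map_mat of_int A"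
  define e where "e = vec v (\<lambda>i. z ^ i)"
  have A: "A \<in> carrier_mat v v" unfolding A_def by simp
  have B: "B \<in> carrier_mat v v" unfolding B_def using A by simp
  have "e \<noteq> 0\<^sub>v v"
  proof
    assume "e = 0\<^sub>v v"
    then have "vec_index e 0 = 0" using assms(2) by simp
    then show False using assms(2) unfolding e_def by simp
  qed
  moreover have "B *\<^sub>v e = x \<cdot>\<^sub>v e"
  proof (rule eq_vecI)
    fix i assume "i < dim_vec (x \<cdot>\<^sub>v e)"
    then have i: "i < v" unfolding e_def by simp
    have "vec_index (B *\<^sub>v e) i = (\<Sum>j<v. of_int (c i j) * z ^ j)"
      using i unfolding B_def A_def e_def by (simp add: scalar_prod_def atLeast0LessThan)
    also have "\<dots> = vec_index (x \<cdot>\<^sub>v e) i" using i unfolding e_def by (simp add: c)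
    finally show "vec_index (B *\<^sub>v e) i = vec_index (x \<cdot>\<^sub>v e) i" .
  qed (simp_all add: B_def A_def e_def)
  ultimately have "eigenvalue B x"
    unfolding eigenvalue_def eigenvector_def using B by (intro exI [of _ e]) (auto simp: e_def)
  then have "poly (char_poly B) x = 0" using eigenvalue_root_char_poly [OF B] by simp
  then have "poly (of_int_poly (char_poly A)) x = 0"
    unfolding B_def of_int_hom.char_poly_hom [OF A] .
  then show ?thesis using that degree_monic_char_poly [OF A] by metis
qed

section \<open>Divisibility in \<open>\<int>[z]\<close>\<close>

text \<open>Divisibility within the ring \<open>\<int>[z]\<close>; the class operation \<open>dvd\<close> on the complex numbers would be trivial.
  It is defined for arbitrary complex \<open>c\<close> and \<open>x\<close>, so that most rules carry no membership conditions.\<close>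
definition dvd_adj :: "complex \<Rightarrow> complex \<Rightarrow> complex \<Rightarrow> bool" where
  "dvd_adj z c x \<longleftrightarrow> (\<exists>y\<in>int_adjoin z. x = c * y)"

lemma dvd_adjI: "y \<in> int_adjoin z \<Longrightarrow> x = c * y \<Longrightarrow> dvd_adj z c x"
  unfolding dvd_adj_def by blast

lemma dvd_adjE [elim]:
  assumes "dvd_adj z c x" obtains y where "y \<in> int_adjoin z" "x = c * y"
  using assms unfolding dvd_adj_def by blast

lemma dvd_adj_0 [simp]: "dvd_adj z c 0"
  by (rule dvd_adjI [of 0]) auto

lemma dvd_adj_refl [simp]: "dvd_adj z c c"
  by (rule dvd_adjI [of 1]) auto

lemma dvd_adj_one_left: "x \<in> int_adjoin z \<Longrightarrow> dvd_adj z 1 x"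
  by (rule dvd_adjI [of x]) auto

lemma dvd_adj_add: "dvd_adj z c x \<Longrightarrow> dvd_adj z c y \<Longrightarrow> dvd_adj z c (x + y)"
  unfolding dvd_adj_def using int_adjoin_add by (metis distrib_left)

lemma dvd_adj_diff: "dvd_adj z c x \<Longrightarrow> dvd_adj z c y \<Longrightarrow> dvd_adj z c (x - y)"
  unfolding dvd_adj_def using int_adjoin_diff by (metis right_diff_distrib)

lemma dvd_adj_uminus: "dvd_adj z c x \<Longrightarrow> dvd_adj z c (- x)"
  using dvd_adj_diff [of z c 0 x] by simp

lemma dvd_adj_mult: "dvd_adj z c x \<Longrightarrow> y \<in> int_adjoin z \<Longrightarrow> dvd_adj z c (x * y)"
  unfolding dvd_adj_def using int_adjoin_mult by (metis mult.assoc)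

lemma dvd_adj_mult2: "dvd_adj z c x \<Longrightarrow> y \<in> int_adjoin z \<Longrightarrow> dvd_adj z c (y * x)"
  using dvd_adj_mult by (simp add: mult.commute)

lemma dvd_adj_mult_mono: "dvd_adj z c x \<Longrightarrow> dvd_adj z d y \<Longrightarrow> dvd_adj z (c * d) (x * y)"
  unfolding dvd_adj_def using int_adjoin_mult by (metis mult.assoc mult.left_commute)

lemma dvd_adj_power_mono: "dvd_adj z c x \<Longrightarrow> dvd_adj z (c ^ k) (x ^ k)"
  by (induction k) (auto intro: dvd_adj_mult_mono)

lemma dvd_adj_prod_mono:
  "(\<And>i. i \<in> A \<Longrightarrow> dvd_adj z (f i) (g i)) \<Longrightarrow> dvd_adj z (prod f A) (prod g A)"
  by (induction A rule: infinite_finite_induct) (auto intro: dvd_adj_mult_mono)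

lemma dvd_adj_trans: "dvd_adj z c d \<Longrightarrow> dvd_adj z d x \<Longrightarrow> dvd_adj z c x"
  unfolding dvd_adj_def using int_adjoin_mult by (metis mult.assoc)

lemma dvd_adj_sum: "(\<And>i. i \<in> A \<Longrightarrow> dvd_adj z c (f i)) \<Longrightarrow> dvd_adj z c (sum f A)"
  by (induction A rule: infinite_finite_induct) (auto intro: dvd_adj_add)

lemma dvd_adj_power_le:
  assumes "c \<in> int_adjoin z" "k \<le> l"
  shows "dvd_adj z (c ^ k) (c ^ l)"
  by (rule dvd_adjI [of "c ^ (l - k)"]) (use assms in \<open>auto simp: power_add [symmetric]\<close>)

lemma dvd_adj_subset: "dvd_adj y c x \<Longrightarrow> y \<in> int_adjoin z \<Longrightarrow> dvd_adj z c x"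
  using int_adjoin_subset unfolding dvd_adj_def by blast

lemma dvd_adj_cancel: "c \<noteq> 0 \<Longrightarrow> dvd_adj z (c * d) (c * x) \<longleftrightarrow> dvd_adj z d x"
  unfolding dvd_adj_def by auto

lemma dvd_adj_of_int: "a dvd b \<Longrightarrow> dvd_adj z (of_int a) (of_int b)"
  by (elim dvdE, rule dvd_adjI [of "of_int _"]) auto

lemma dvd_adj_power_diff:
  assumes "x \<in> int_adjoin z" "y \<in> int_adjoin z" "dvd_adj z c (x - y)"
  shows "dvd_adj z c (x ^ k - y ^ k)"
proof (cases k)
  case (Suc n)
  show ?thesis unfolding Suc diff_power_eq_sum
    by (rule dvd_adj_mult [OF assms(3)]) (use assms in auto)
qed simp

lemma dvd_adj_poly_diff:
  assumes "x \<in> int_adjoin z" "y \<in> int_adjoin z" "dvd_adj z c (x - y)"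
  shows "dvd_adj z c (poly (of_int_poly f) x - poly (of_int_poly f) y)"
proof (induction f)
  case (pCons a f)
  have "poly (of_int_poly f) x \<in> int_adjoin x" unfolding int_adjoin_def by blast
  then have "poly (of_int_poly f) x \<in> int_adjoin z" using int_adjoin_subset assms(1) by blast
  then have "dvd_adj z c ((x - y) * poly (of_int_poly f) x
      + y * (poly (of_int_poly f) x - poly (of_int_poly f) y))"
    using assms pCons.IH by (intro dvd_adj_add dvd_adj_mult dvd_adj_mult2)
  then show ?case by (simp add: of_int_hom.map_poly_pCons_hom algebra_simps)
qed simp

section \<open>The Frobenius congruence and its consequences\<close>

lemma freshmans_dream:
  assumes "prime q" "x \<in> int_adjoin z" "y \<in> int_adjoin z"
  shows "dvd_adj z (of_nat q) ((x + y) ^ q - (x ^ q + y ^ q))"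
proof -
  have q: "q > 1" using assms(1) prime_gt_1_nat by blast
  have "(x + y) ^ q = (\<Sum>k\<in>{..q}. of_nat (q choose k) * x ^ k * y ^ (q - k))"
    by (rule binomial_ring)
  also have "{..q} = insert 0 (insert q {1..<q})" using q by auto
  also have "(\<Sum>k\<in>\<dots>. of_nat (q choose k) * x ^ k * y ^ (q - k))
      = y ^ q + (x ^ q + (\<Sum>k\<in>{1..<q}. of_nat (q choose k) * x ^ k * y ^ (q - k)))"
    using q by simp
  finally have "(x + y) ^ q - (x ^ q + y ^ q)
      = (\<Sum>k\<in>{1..<q}. of_nat (q choose k) * x ^ k * y ^ (q - k))" by simp
  also have "dvd_adj z (of_nat q) \<dots>"
  proof (intro dvd_adj_sum dvd_adj_mult)
    fix k assume k: "k \<in> {1..<q}"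
    have "q dvd (q choose k)" by (rule dvd_choose_prime) (use k assms(1) in auto)
    then have "int q dvd int (q choose k)" by simp
    then show "dvd_adj z (of_nat q) (of_nat (q choose k))"
      using dvd_adj_of_int [of "int q" "int (q choose k)" z] by simp
  qed (use assms in auto)
  finally show ?thesis .
qed

lemma prime_dvd_power_diff_self:
  assumes "prime q"
  shows "int q dvd c ^ q - c"
proof -
  define a where "a = nat (c mod int q)"
  have q: "q > 1" using assms prime_gt_1_nat by blast
  have ca: "[c = int a] (mod int q)" unfolding a_def cong_def using q by simp
  have "[a ^ q = a] (mod q)"
  proof (cases "q dvd a")
    case True
    then have "q dvd a ^ q" using q dvd_trans [OF True dvd_power [of q a]] by simp
    then show ?thesis using True by (simp add: cong_def)
  next
    case False
    have "[a * a ^ (q - 1) = a * 1] (mod q)"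
      by (rule cong_scalar_left [OF fermat_theorem [OF assms False]])
    then show ?thesis using q by (simp add: power_eq_if)
  qed
  then have "[int a ^ q = int a] (mod int q)" by (metis cong_int_iff of_nat_power)
  then have "[c ^ q = c] (mod int q)" using ca by (metis cong_pow cong_sym cong_trans)
  then show ?thesis by (simp add: cong_iff_dvd_diff)
qed

text \<open>Modulo a prime \<open>q\<close>, raising to the power \<open>q ^ j\<close> only moves the generator. For a root of unity of
  order coprime to \<open>q\<close> this replaces the Frobenius automorphism.\<close>
lemma frobenius:
  assumes "prime q"
  shows "dvd_adj z (of_nat q) (poly (of_int_poly f) z ^ (q ^ j) - poly (of_int_poly f) (z ^ (q ^ j)))"
proof (induction j)
  case (Suc j)
  have mem: "poly (of_int_poly g) (z ^ k) \<in> int_adjoin z" for g k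
    using int_adjoin_subset [of "z ^ k" z] unfolding int_adjoin_def [of "z ^ k"] by blast
  have one: "dvd_adj z (of_nat q) (poly (of_int_poly g) y ^ q - poly (of_int_poly g) (y ^ q))"
    if y: "y \<in> int_adjoin z" for g y
  proof (induction g)
    case 0
    show ?case using prime_gt_0_nat [OF assms] by (simp add: power_0_left)
  next
    case (pCons a g)
    let ?g = "\<lambda>w. poly (of_int_poly g) w"
    have g: "?g y \<in> int_adjoin z"
      using int_adjoin_subset [OF y] unfolding int_adjoin_def [of y] by blast
    have yg: "y * ?g y \<in> int_adjoin z" using g y by auto
    have "dvd_adj z (of_nat q) (((of_int a + y * ?g y) ^ q - (of_int a ^ q + (y * ?g y) ^ q))
        + (of_int (a ^ q - a) + y ^ q * (?g y ^ q - ?g (y ^ q))))"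
      using dvd_adj_of_int [OF prime_dvd_power_diff_self [OF assms, of a], of z] g y pCons.IH
      by (intro dvd_adj_add dvd_adj_mult2 freshmans_dream assms yg) auto
    then show ?case by (simp add: of_int_hom.map_poly_pCons_hom algebra_simps power_mult_distrib)
  qed
  let ?f = "\<lambda>w. poly (of_int_poly f) w"
  have "dvd_adj z (of_nat q) ((?f z ^ q ^ j) ^ q - ?f (z ^ q ^ j) ^ q)"
    using Suc mem [of _ 1] mem by (intro dvd_adj_power_diff) auto
  then have "dvd_adj z (of_nat q) (((?f z ^ q ^ j) ^ q - ?f (z ^ q ^ j) ^ q)
     + (?f (z ^ q ^ j) ^ q - ?f ((z ^ q ^ j) ^ q)))"
    by (intro dvd_adj_add one) auto
  then show ?case by (simp add: power_mult [symmetric] mult.commute)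
qed simp

text \<open>For a root of unity \<open>y\<close> of order coprime to \<open>q\<close> the ring \<open>\<int>[y]\<close> has two good properties at \<open>q\<close>: its
  quotient by \<open>q\<close> is reduced, because some power of the Frobenius map is the identity there, and no
  divisibility by \<open>q\<close> is gained by passing to a larger cyclotomic ring, because elements of the latter are
  integral. Both are combined here: if \<open>q\<close> divides a power of \<open>x\<close> in the larger ring \<open>\<int>[z]\<close>, it divides
  \<open>x\<close> in \<open>\<int>[y]\<close>.\<close>
lemma saturation:
  assumes "prime q" "coprime q w" "y ^ w = 1" "w > 0" "z ^ v = 1" "v > 0"
    and "x \<in> int_adjoin y" "dvd_adj z (of_nat q) (x ^ M)" "M > 0"
  shows "dvd_adj y (of_nat q) x"
proof -
  obtain t where t: "t \<in> int_adjoin z" "x ^ M = of_nat q * t" using assms(8) by blast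
  obtain f where f: "lead_coeff f = 1" "degree f = v" "poly (of_int_poly f) t = (0 :: complex)"
    using int_adjoin_root_of_unity_integral [OF assms(5,6) t(1)] by metis
  \<comment> \<open>an integral equation for \<open>t = x ^ M / q\<close>, multiplied by \<open>q ^ v\<close>, exhibits a power of \<open>x\<close> as a multiple of \<open>q\<close> in \<open>\<int>[y]\<close>\<close>
  have "0 = of_nat q ^ v * poly (of_int_poly f) t" using f by simp
  also have "\<dots> = (\<Sum>i\<le>v. of_int (poly.coeff f i) * (of_nat q ^ v * t ^ i))"
    unfolding poly_altdef by (simp add: f sum_distrib_left algebra_simps)
  also have "\<dots> = (\<Sum>i\<le>v. of_int (poly.coeff f i) * (of_nat q ^ (v - i) * (x ^ M) ^ i))"
  proof (rule sum.cong)
    fix i assume "i \<in> {..v}"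
    then have "of_nat q ^ v = (of_nat q ^ (v - i) * of_nat q ^ i :: complex)"
      by (simp add: power_add [symmetric])
    then show "of_int (poly.coeff f i) * (of_nat q ^ v * t ^ i)
        = of_int (poly.coeff f i) * (of_nat q ^ (v - i) * (x ^ M) ^ i)"
      by (simp add: t power_mult_distrib)
  qed simp
  also have "\<dots> = (\<Sum>i<v. of_int (poly.coeff f i) * (of_nat q ^ (v - i) * (x ^ M) ^ i)) + x ^ (M * v)"
    using f by (simp add: lessThan_Suc_atMost [symmetric] power_mult)
  finally have "x ^ (M * v) = - (\<Sum>i<v. of_int (poly.coeff f i) * (of_nat q ^ (v - i) * (x ^ M) ^ i))"
    by (simp add: eq_neg_iff_add_eq_0 add.commute)
  also have "dvd_adj y (of_nat q) \<dots>"
  proof (intro dvd_adj_uminus dvd_adj_sum)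
    fix i assume "i \<in> {..<v}"
    then have "dvd_adj y (of_nat q) (of_nat q ^ (v - i))"
      using dvd_adj_power_le [of "of_nat q" y 1 "v - i"] by simp
    then show "dvd_adj y (of_nat q) (of_int (poly.coeff f i) * (of_nat q ^ (v - i) * (x ^ M) ^ i))"
      using assms(7) by (intro dvd_adj_mult2 [OF dvd_adj_mult]) auto
  qed
  finally have d: "dvd_adj y (of_nat q) (x ^ (M * v))" .
  \<comment> \<open>\<open>q ^ J\<close> fixes \<open>y\<close> as an exponent and exceeds \<open>M * v\<close>, so \<open>x\<close> is congruent to a multiple of \<open>x ^ (M * v)\<close>\<close>
  define J where "J = totient w * (M * v)"
  have q: "q > 1" using assms(1) prime_gt_1_nat by blast
  have "J < q ^ J" using q by (simp add: less_exp power_gt_expt)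
  moreover have "M * v \<le> J" unfolding J_def using mult_le_mono1 [of 1 "totient w" "M * v"] assms(4)
    by (simp add: Suc_le_eq)
  ultimately have le: "M * v \<le> q ^ J" by simp
  have "[(q ^ totient w) ^ (M * v) = 1 ^ (M * v)] (mod w)"
    by (rule cong_pow [OF euler_theorem [OF assms(2)]])
  then have qJ: "[q ^ J = 1] (mod w)"
    by (simp only: J_def power_mult [of q "totient w" "M * v"] power_one)
  have yJ: "y ^ (q ^ J) = y"
  proof -
    have "w dvd q ^ J - 1" using cong_to_1_nat [OF qJ] .
    then obtain k where "q ^ J - 1 = w * k" by (rule dvdE)
    then have "q ^ J = 1 + w * k" using q by (metis le_add_diff_inverse one_le_power less_imp_le)
    then show ?thesis by (simp add: power_add power_mult assms)
  qed
  obtain g where g: "x = poly (of_int_poly g) y" using assms(7) unfolding int_adjoin_def by auto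
  have "dvd_adj y (of_nat q) (x ^ (q ^ J) - x)"
    using frobenius [OF assms(1), of y g J] by (simp add: g yJ)
  moreover have "dvd_adj y (of_nat q) (x ^ (M * v) * x ^ (q ^ J - M * v))"
    using assms(7) by (intro dvd_adj_mult [OF d]) auto
  then have "dvd_adj y (of_nat q) (x ^ (q ^ J))" using le by (simp add: power_add [symmetric])
  ultimately have "dvd_adj y (of_nat q) (x ^ (q ^ J) - (x ^ (q ^ J) - x))"
    by (rule dvd_adj_diff [rotated])
  then show ?thesis by simp
qed

lemma saturation_power:
  assumes "prime q" "coprime q w" "y ^ w = 1" "w > 0" "z ^ v = 1" "v > 0"
    and "x \<in> int_adjoin y" "dvd_adj z (of_nat q ^ a) x"
  shows "dvd_adj y (of_nat q ^ a) x"
  using assms(7,8)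
proof (induction a arbitrary: x)
  case 0
  then show ?case by (auto intro: dvd_adj_one_left)
next
  case (Suc a)
  have q: "of_nat q \<noteq> (0 :: complex)" using assms(1) by auto
  have "dvd_adj z (of_nat q ^ 1) (of_nat q ^ Suc a)" by (rule dvd_adj_power_le) auto
  then have "dvd_adj z (of_nat q) (x ^ 1)"
    using dvd_adj_trans [OF _ Suc.prems(2), of "of_nat q"] by simp
  then have "dvd_adj y (of_nat q) x" by (rule saturation [OF assms(1-6) Suc.prems(1)]) simp
  then obtain x' where x': "x' \<in> int_adjoin y" "x = of_nat q * x'" by (rule dvd_adjE)
  have "dvd_adj z (of_nat q ^ a) x'" using Suc.prems(2) q by (simp add: x' dvd_adj_cancel)
  then have "dvd_adj y (of_nat q ^ a) x'" by (rule Suc.IH [OF x'(1)])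
  then show ?case using q by (simp add: x' dvd_adj_cancel)
qed

text \<open>The case \<open>y = 1\<close>: divisibility of integers in a cyclotomic ring is ordinary divisibility.\<close>
lemma dvd_adj_of_int_imp_dvd:
  assumes "prime q" "z ^ v = 1" "v > 0" "dvd_adj z (of_nat q ^ a) (of_int k)"
  shows "int q ^ a dvd k"
proof -
  have "dvd_adj 1 (of_nat q ^ a) (of_int k :: complex)"
    by (rule saturation_power [OF assms(1) _ _ _ assms(2,3) _ assms(4), of 1]) auto
  then obtain y where y: "y \<in> int_adjoin 1" "of_int k = of_nat q ^ a * y" by blast
  obtain c :: "nat \<Rightarrow> int" where "y = (\<Sum>j<1. of_int (c j) * 1 ^ j)"
    using int_adjoin_root_of_unity_sum [of 1 1 y] y by auto
  then have "of_int k = (of_int (int q ^ a * c 0) :: complex)" using y by simp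
  then have "k = int q ^ a * c 0" unfolding of_int_eq_iff .
  then show ?thesis by simp
qed

section \<open>Roots of unity\<close>

lemma primitive_root_power_eq_1_iff:
  assumes "primitive_root_of_unity v z"
  shows "z ^ k = 1 \<longleftrightarrow> v dvd k"
proof
  have v: "v > 0" "z ^ v = 1" and min: "\<And>k. 0 < k \<Longrightarrow> k < v \<Longrightarrow> z ^ k \<noteq> 1"
    using assms unfolding primitive_root_of_unity_def by auto
  assume "z ^ k = 1"
  moreover have "z ^ k = z ^ (v * (k div v) + k mod v)" by simp
  ultimately have "z ^ (k mod v) = 1" unfolding power_add power_mult using v by simp
  then have "k mod v = 0" using min [of "k mod v"] v by auto
  then show "v dvd k" by auto
next
  assume "v dvd k"
  then show "z ^ k = 1" using assms by (auto simp: power_mult primitive_root_of_unity_def)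
qed

lemma primitive_root_of_unity_exists:
  assumes "v > 0"
  obtains z where "primitive_root_of_unity v z"
proof
  let ?z = "exp (2 * of_real pi * \<i> / of_nat v) :: complex"
  have *: "?z ^ k = exp (2 * of_real pi * \<i> * of_nat k / of_nat v)" for k
    by (simp add: exp_of_nat_mult [symmetric] algebra_simps)
  have "?z ^ k = 1 \<longleftrightarrow> v dvd k" for k
    unfolding * using assms by (intro complex_root_unity_eq_1) auto
  then show "primitive_root_of_unity v ?z"
    unfolding primitive_root_of_unity_def using assms by (auto dest: nat_dvd_not_less)
qed

lemma primitive_root_power:
  assumes "primitive_root_of_unity (a * b) z" "a > 0"
  shows "primitive_root_of_unity b (z ^ a)"
  unfolding primitive_root_of_unity_def
proof (intro conjI allI impI)
  show "b > 0" using assms unfolding primitive_root_of_unity_def by simp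
  show "(z ^ a) ^ b = 1" unfolding power_mult [symmetric] primitive_root_power_eq_1_iff [OF assms(1)] by simp
  fix k assume "0 < k \<and> k < b"
  then show "(z ^ a) ^ k \<noteq> 1"
    unfolding power_mult [symmetric] primitive_root_power_eq_1_iff [OF assms(1)] using assms(2)
    by (auto dest: nat_dvd_not_less)
qed

lemma root_of_unity_norm: "z ^ v = 1 \<Longrightarrow> v > 0 \<Longrightarrow> cmod z = 1"
  by (metis norm_one norm_power norm_ge_zero power_eq_1_iff gr_implies_not0 abs_norm_cancel real_norm_def)

lemma root_of_unity_mult_cnj: "z ^ v = 1 \<Longrightarrow> v > 0 \<Longrightarrow> z * cnj z = 1"
  using root_of_unity_norm [of z v] by (metis complex_norm_square of_real_1 one_power2)

lemma primitive_root_power_inj: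
  assumes "primitive_root_of_unity v z"
  shows "inj_on (\<lambda>k. z ^ k) {..<v}"
proof -
  have *: "i = j" if "i \<le> j" "j < v" "z ^ i = z ^ j" for i j
  proof -
    have "z \<noteq> 0" using assms by (auto simp: primitive_root_of_unity_def power_0_left split: if_splits)
    have "z ^ (i + (j - i)) = z ^ j" using that(1) by simp
    then have "z ^ i * z ^ (j - i) = z ^ i * 1" unfolding power_add using that(3) by simp
    then have "z ^ (j - i) = 1" using \<open>z \<noteq> 0\<close> by simp
    then have "v dvd j - i" using primitive_root_power_eq_1_iff [OF assms] by simp
    then show ?thesis using that by (metis dvd_imp_le diff_is_0_eq le_antisym less_imp_diff_less not_le not_gr_zero)
  qed
  show ?thesis by (rule inj_onI) (metis * lessThan_iff nat_le_linear)
qed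

lemma root_of_unity_eq_power:
  assumes "primitive_root_of_unity v z" "x ^ v = 1"
  obtains j where "j < v" "x = z ^ j"
proof -
  have v: "v > 0" using assms(1) unfolding primitive_root_of_unity_def by simp
  have "(\<lambda>k. z ^ k) ` {..<v} = {x. x ^ v = 1}"
  proof (rule card_seteq)
    show "finite {x :: complex. x ^ v = 1}" using v by (intro finite_roots_unity) simp
    show "(\<lambda>k. z ^ k) ` {..<v} \<subseteq> {x. x ^ v = 1}"
      using assms(1) by (auto simp: power_mult [symmetric] primitive_root_power_eq_1_iff)
    show "card {x :: complex. x ^ v = 1} \<le> card ((\<lambda>k. z ^ k) ` {..<v})"
      using card_roots_unity [of v] v primitive_root_power_inj [OF assms(1)] by (simp add: card_image)
  qed
  then show ?thesis using that assms(2) by blast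
qed

section \<open>Half of a norm at a self-conjugate prime\<close>

text \<open>The condition on \<open>z ^ (q ^ j + 1)\<close> says that \<open>q ^ j\<close> acts on \<open>z\<close> like conjugation modulo \<open>\<pi>\<close>. By the
  Frobenius congruence it then acts so on the whole ring.\<close>
lemma frobenius_cong_cnj:
  assumes "prime q" "z ^ v = 1" "v > 0"
    and "dvd_adj z \<pi> (of_nat q)" "dvd_adj z \<pi> (z ^ (q ^ j + 1) - 1)" "x \<in> int_adjoin z"
  shows "dvd_adj z \<pi> (x ^ (q ^ j) - cnj x)"
proof -
  obtain f where f: "x = poly (of_int_poly f) z" using assms(6) unfolding int_adjoin_def by auto
  have cx: "cnj x = poly (of_int_poly f) (cnj z)" unfolding f by (induction f) (simp_all add: of_int_hom.map_poly_pCons_hom)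
  have cz: "cnj z \<in> int_adjoin z"
    using int_adjoin_cnj [OF assms(2,3) root_of_unity_norm [OF assms(2,3)]] by blast
  have "cnj z * (z ^ (q ^ j + 1) - 1) = (z * cnj z) * z ^ (q ^ j) - cnj z" by (simp add: algebra_simps)
  then have "z ^ (q ^ j) - cnj z = cnj z * (z ^ (q ^ j + 1) - 1)"
    unfolding root_of_unity_mult_cnj [OF assms(2,3)] by simp
  then have "dvd_adj z \<pi> (z ^ (q ^ j) - cnj z)" using dvd_adj_mult2 [OF assms(5) cz] by metis
  then have "dvd_adj z \<pi> (poly (of_int_poly f) (z ^ (q ^ j)) - poly (of_int_poly f) (cnj z))"
    by (intro dvd_adj_poly_diff) (auto simp: cz)
  moreover have "dvd_adj z \<pi> (x ^ (q ^ j) - poly (of_int_poly f) (z ^ (q ^ j)))"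
    unfolding f by (rule dvd_adj_trans [OF assms(4) frobenius [OF assms(1)]])
  ultimately have "dvd_adj z \<pi> (x ^ (q ^ j) - poly (of_int_poly f) (z ^ (q ^ j))
      + (poly (of_int_poly f) (z ^ (q ^ j)) - poly (of_int_poly f) (cnj z)))" by (intro dvd_adj_add)
  then show ?thesis unfolding cx by simp
qed

text \<open>The descent that replaces prime ideals. If \<open>\<pi>\<close> divides \<open>x * cnj x\<close>, which is congruent to
  \<open>x ^ (Q + 1)\<close>, then it divides \<open>x ^ (Q * Q)\<close>, which is congruent to \<open>x\<close>. Dividing \<open>x\<close> by \<open>\<pi>\<close> divides
  \<open>x * cnj x\<close> by \<open>\<pi> ^ 2\<close> up to a unit, so the argument can be repeated; the rounding up comes from the
  last step with \<open>k = 1\<close>.\<close>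
lemma half_valuation:
  assumes R: "z ^ v = 1" "v > 0" and pi: "\<pi> \<in> int_adjoin z" "\<pi> \<noteq> 0" "dvd_adj z (cnj \<pi>) \<pi>"
    and Q: "Q \<ge> 2" and frob: "\<And>x. x \<in> int_adjoin z \<Longrightarrow> dvd_adj z \<pi> (x ^ Q - cnj x)"
    and "x \<in> int_adjoin z" "dvd_adj z (\<pi> ^ k) (x * cnj x)"
  shows "dvd_adj z (\<pi> ^ ((k + 1) div 2)) x"
  using assms(8,9)
proof (induction k arbitrary: x rule: less_induct)
  case (less k)
  have cnj: "cnj y \<in> int_adjoin z" if "y \<in> int_adjoin z" for y
    using int_adjoin_cnj [OF R root_of_unity_norm [OF R] that] .
  show ?case
  proof (cases "k = 0")
    case True
    then show ?thesis using less.prems by (auto intro: dvd_adj_one_left)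
  next
    case False
    have "dvd_adj z \<pi> (x * cnj x)"
      using False dvd_adj_trans [OF dvd_adj_power_le [OF pi(1), of 1 k] less.prems(2)] by simp
    then have "dvd_adj z \<pi> (x * (x ^ Q - cnj x) + x * cnj x)"
      by (rule dvd_adj_add [OF dvd_adj_mult2 [OF frob [OF less.prems(1)] less.prems(1)]])
    then have x1: "dvd_adj z \<pi> (x ^ (Q + 1))" by (simp add: algebra_simps)
    have "Q + 1 \<le> Q * Q" using Q mult_le_mono1 [OF Q, of Q] by linarith
    have "dvd_adj z \<pi> (x ^ (Q + 1) * x ^ (Q * Q - (Q + 1)))"
      by (rule dvd_adj_mult [OF x1 int_adjoin_power [OF less.prems(1)]])
    moreover have "x ^ (Q + 1) * x ^ (Q * Q - (Q + 1)) = x ^ (Q * Q)"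
      by (simp only: power_add [symmetric] le_add_diff_inverse [OF \<open>Q + 1 \<le> Q * Q\<close>])
    ultimately have xQ: "dvd_adj z \<pi> (x ^ (Q * Q))" by simp
    have xc: "cnj x \<in> int_adjoin z" by (rule cnj [OF less.prems(1)])
    have "dvd_adj z \<pi> ((x ^ Q) ^ Q - cnj x ^ Q)"
      by (rule dvd_adj_power_diff [OF int_adjoin_power [OF less.prems(1)] xc frob [OF less.prems(1)]])
    moreover have "dvd_adj z \<pi> (cnj x ^ Q - cnj (cnj x))" by (rule frob [OF xc])
    ultimately have "dvd_adj z \<pi> (x ^ (Q * Q) - ((x ^ Q) ^ Q - cnj x ^ Q) - (cnj x ^ Q - cnj (cnj x)))"
      by (rule dvd_adj_diff [OF dvd_adj_diff [OF xQ]])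
    moreover have "x ^ (Q * Q) - ((x ^ Q) ^ Q - cnj x ^ Q) - (cnj x ^ Q - cnj (cnj x)) = x"
      by (simp add: power_mult)
    ultimately have "dvd_adj z \<pi> x" by (simp only:)
    then obtain y where y: "y \<in> int_adjoin z" "x = \<pi> * y" by (rule dvd_adjE)
    show ?thesis
    proof (cases "k = 1")
      case True
      then show ?thesis using dvd_adjI [OF y] by simp
    next
      case False
      define l where "l = k - 2"
      have l: "k = l + 2" using \<open>k \<noteq> 0\<close> False by (simp add: l_def)
      obtain d where d: "d \<in> int_adjoin z" "\<pi> = cnj \<pi> * d" using pi(3) by (rule dvd_adjE)
      have "\<pi> ^ 2 * (y * cnj y) = (cnj \<pi> * d) * (\<pi> * (y * cnj y))"
        unfolding d(2) [symmetric] by (simp add: power2_eq_square)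
      also have "\<dots> = x * cnj x * d" by (simp add: y algebra_simps)
      finally have "dvd_adj z (\<pi> ^ k) (\<pi> ^ 2 * (y * cnj y))"
        using dvd_adj_mult [OF less.prems(2) d(1)] by simp
      moreover have "\<pi> ^ k = \<pi> ^ 2 * \<pi> ^ l" unfolding l power_add by simp
      ultimately have "dvd_adj z (\<pi> ^ l) (y * cnj y)"
        using pi(2) dvd_adj_cancel [of "\<pi> ^ 2" z "\<pi> ^ l" "y * cnj y"] by simp
      then have "dvd_adj z (\<pi> ^ ((l + 1) div 2)) y" by (rule less.IH [OF _ y(1), rotated]) (simp add: l)
      moreover have "\<pi> ^ ((k + 1) div 2) = \<pi> * \<pi> ^ ((l + 1) div 2)" by (simp add: l)
      ultimately show ?thesis unfolding y(2) by (simp only: dvd_adj_cancel [OF pi(2)])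
    qed
  qed
qed

section \<open>Ramification at prime power order\<close>

lemma card_non_multiples:
  assumes "q > 0"
  shows "card {k. k < q * t \<and> \<not> q dvd k} = t * (q - 1)"
proof -
  let ?M = "(\<lambda>i. q * i) ` {..<t}"
  have "card ?M = t" using assms by (subst card_image) (auto simp: inj_on_def)
  moreover have "?M \<subseteq> {..<q * t}" using assms by auto
  ultimately have "card ({..<q * t} - ?M) = q * t - t" by (subst card_Diff_subset) simp_all
  moreover have "{k. k < q * t \<and> \<not> q dvd k} = {..<q * t} - ?M" using assms by auto
  ultimately show ?thesis by (simp add: algebra_simps)
qed

lemma root_of_unity_sum_eq_0:
  fixes x :: complex
  assumes "x ^ n = 1" "x \<noteq> 1"
  shows "(\<Sum>i<n. x ^ i) = 0"
  using assms by (simp add: geometric_sum)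

text \<open>This is the value at \<open>1\<close> of the cyclotomic polynomial of order \<open>q ^ Suc e\<close>, which is the sum \<open>g\<close> below
  and also the product of the linear factors \<open>x - \<alpha> ^ k\<close> with \<open>k\<close> prime to \<open>q\<close>.\<close>
lemma prod_one_minus_primitive_roots:
  assumes "prime q" "primitive_root_of_unity (q ^ Suc e) \<alpha>"
  shows "(\<Prod>k\<in>{k. k < q ^ Suc e \<and> \<not> q dvd k}. 1 - \<alpha> ^ k) = of_nat q"
proof -
  define t where "t = q ^ e"
  define U where "U = {k. k < q ^ Suc e \<and> \<not> q dvd k}"
  have q: "q > 1" using assms(1) prime_gt_1_nat by blast
  have t: "t > 0" using q by (simp add: t_def)
  have U: "finite U" "card U = t * (q - 1)"
    unfolding U_def t_def using card_non_multiples [of q "q ^ e"] q by auto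
  define g :: "complex poly" where "g = (\<Sum>l<q. Polynomial.monom 1 (l * t))"
  define h :: "complex poly" where "h = (\<Prod>k\<in>U. [:- (\<alpha> ^ k), 1:])"
  have "degree h = card U"
    unfolding h_def by (subst degree_prod_eq_sum_degree) auto
  moreover have "lead_coeff h = 1" unfolding h_def by (simp add: lead_coeff_prod)
  ultimately have h: "degree h = t * (q - 1)" "poly.coeff h (t * (q - 1)) = 1" using U by auto
  have "g = h"
  proof (rule poly_eqI_degree_lead_coeff)
    have "poly.coeff g (t * (q - 1)) = (\<Sum>l<q. if l = q - 1 then 1 else 0)"
      unfolding g_def coeff_sum by (intro sum.cong) (use t in auto)
    then show "poly.coeff g (t * (q - 1)) = poly.coeff h (t * (q - 1))" using q h by simp
    show "degree g \<le> t * (q - 1)" unfolding g_def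
    proof (rule degree_sum_le)
      fix l assume "l \<in> {..<q}"
      then have "l * t \<le> (q - 1) * t" by (intro mult_right_mono) auto
      then show "degree (Polynomial.monom (1 :: complex) (l * t)) \<le> t * (q - 1)"
        by (simp add: degree_monom_eq mult.commute)
    qed simp
    show "degree h \<le> t * (q - 1)" using h by simp
    have "inj_on (\<lambda>k. \<alpha> ^ k) U"
      by (rule inj_on_subset [OF primitive_root_power_inj [OF assms(2)]]) (auto simp: U_def)
    then show "t * (q - 1) \<le> card ((\<lambda>k. \<alpha> ^ k) ` U)" using U by (simp add: card_image)
    fix x assume "x \<in> (\<lambda>k. \<alpha> ^ k) ` U"
    then obtain k where k: "k \<in> U" "x = \<alpha> ^ k" by auto
    have "poly h x = 0" unfolding h_def poly_prod using k U by (auto intro!: prod_zero)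
    moreover have "poly g x = (\<Sum>l<q. (\<alpha> ^ (k * t)) ^ l)"
      unfolding g_def poly_sum k by (simp add: poly_monom power_mult [symmetric] algebra_simps)
    moreover have "\<dots> = 0"
    proof (rule root_of_unity_sum_eq_0)
      show "(\<alpha> ^ (k * t)) ^ q = 1"
        unfolding power_mult [symmetric] primitive_root_power_eq_1_iff [OF assms(2)] by (simp add: t_def)
      show "\<alpha> ^ (k * t) \<noteq> 1"
        unfolding primitive_root_power_eq_1_iff [OF assms(2)] using k t by (simp add: U_def t_def)
    qed
    ultimately show "poly g x = poly h x" by simp
  qed
  then have "poly g 1 = poly h 1" by simp
  then show ?thesis by (simp add: g_def h_def poly_sum poly_prod poly_monom U_def)
qed

lemma one_minus_root_dvd_one_minus_power: "y \<in> int_adjoin z \<Longrightarrow> dvd_adj z (1 - y) (1 - y ^ k)"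
  using dvd_adj_power_diff [of 1 z y "1 - y" k] by simp

text \<open>Total ramification: \<open>q\<close> is the product of the \<open>1 - \<alpha> ^ k\<close>, and each factor is associated to \<open>1 - \<alpha>\<close>
  because \<open>\<alpha> ^ k\<close> and \<open>\<alpha>\<close> are powers of each other.\<close>
lemma prime_associated_power:
  assumes "prime q" "primitive_root_of_unity (q ^ Suc e) \<alpha>"
  shows "dvd_adj \<alpha> ((1 - \<alpha>) ^ (q ^ e * (q - 1))) (of_nat q)"
    and "dvd_adj \<alpha> (of_nat q) ((1 - \<alpha>) ^ (q ^ e * (q - 1)))"
proof -
  define U where "U = {k. k < q ^ Suc e \<and> \<not> q dvd k}"
  have "card U = q ^ e * (q - 1)"
    using card_non_multiples [of q "q ^ e"] prime_gt_0_nat [OF assms(1)] by (simp add: U_def)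
  then have p: "(\<Prod>k\<in>U. 1 - \<alpha>) = (1 - \<alpha>) ^ (q ^ e * (q - 1))" by simp
  have q: "(\<Prod>k\<in>U. 1 - \<alpha> ^ k) = of_nat q"
    unfolding U_def by (rule prod_one_minus_primitive_roots [OF assms])
  show "dvd_adj \<alpha> ((1 - \<alpha>) ^ (q ^ e * (q - 1))) (of_nat q)"
    unfolding p [symmetric] q [symmetric]
    by (intro dvd_adj_prod_mono one_minus_root_dvd_one_minus_power) auto
  show "dvd_adj \<alpha> (of_nat q) ((1 - \<alpha>) ^ (q ^ e * (q - 1)))"
    unfolding p [symmetric] q [symmetric]
  proof (rule dvd_adj_prod_mono)
    fix k assume "k \<in> U"
    then have "\<not> q dvd k" by (simp add: U_def)
    then have "coprime k (q ^ Suc e)"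
      using prime_imp_coprime [OF assms(1)] by (metis coprime_commute coprime_power_right_iff)
    then obtain l where l: "[k * l = 1] (mod q ^ Suc e)" using cong_solve_coprime_nat [of k "q ^ Suc e"] by auto
    have "\<alpha> ^ (k * l) = \<alpha>"
    proof -
      have "\<alpha> ^ (m mod q ^ Suc e) = \<alpha> ^ m" for m
      proof -
        have "\<alpha> ^ m = \<alpha> ^ (q ^ Suc e * (m div q ^ Suc e) + m mod q ^ Suc e)" by simp
        then show ?thesis using assms(2) unfolding power_add power_mult primitive_root_of_unity_def by simp
      qed
      then show ?thesis using l unfolding cong_def by (metis power_one_right)
    qed
    then show "dvd_adj \<alpha> (1 - \<alpha> ^ k) (1 - \<alpha>)"
      using one_minus_root_dvd_one_minus_power [of "\<alpha> ^ k" \<alpha> l] by (auto simp: power_mult)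
  qed
qed

section \<open>Self-conjugate primes\<close>

text \<open>A positive exponent is needed to have \<open>q ^ k \<ge> 2\<close> in the descent, whereas \<open>j = 0\<close> may occur if \<open>w\<close>
  divides \<open>2\<close>.\<close>
lemma self_conjugate_exponent:
  assumes "coprime q w" "w > 0" "[int q ^ j = -1] (mod int w)"
  obtains k where "k \<ge> 1" "w dvd q ^ k + 1"
proof
  let ?k = "totient w + j"
  show "?k \<ge> 1" using assms(2) by (simp add: Suc_le_eq)
  have "[int (q ^ totient w) = int 1] (mod int w)"
    using euler_theorem [OF assms(1)] cong_int_iff by blast
  then have "[int q ^ totient w * int q ^ j = 1 * (-1)] (mod int w)"
    using assms(3) by (intro cong_mult) simp_all
  then have "int w dvd int q ^ ?k - (-1)" by (simp add: cong_iff_dvd_diff power_add)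
  then have "int w dvd int (q ^ ?k + 1)" by (simp add: add.commute)
  then show "w dvd q ^ ?k + 1" by (simp only: of_nat_dvd_iff)
qed

lemma prime_power_ge_2: "prime q \<Longrightarrow> j \<ge> 1 \<Longrightarrow> q ^ j \<ge> (2 :: nat)"
  using prime_ge_2_nat [of q] self_le_power [of q j] by linarith

lemma dvd_norm_from_dvd_adj:
  assumes "prime q" "z ^ v = 1" "v > 0" "x * cnj x = of_int N" "dvd_adj z (of_nat q ^ s) x"
  shows "int q ^ (2 * s) dvd N"
proof -
  obtain y where y: "y \<in> int_adjoin z" "x = of_nat q ^ s * y" using assms(5) by (rule dvd_adjE)
  have "cnj y \<in> int_adjoin z"
    by (rule int_adjoin_cnj [OF assms(2,3) root_of_unity_norm [OF assms(2,3)] y(1)])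
  then have "y * cnj y \<in> int_adjoin z" using y(1) by (intro int_adjoin_mult)
  moreover have "of_int N = of_nat q ^ (2 * s) * (y * cnj y)"
    unfolding assms(4) [symmetric] y(2) by (simp only: mult_2 power_add) simp
  ultimately have "dvd_adj z (of_nat q ^ (2 * s)) (of_int N)" by (rule dvd_adjI)
  then show ?thesis by (rule dvd_adj_of_int_imp_dvd [OF assms(1-3)])
qed

lemma dvd_adj_of_int_power: "int q ^ r dvd N \<Longrightarrow> dvd_adj z (of_nat q ^ r) (of_int N)"
  using dvd_adj_of_int [of "int q ^ r" N z] by simp

text \<open>If \<open>q\<close> is prime to the order of \<open>z\<close>, the descent runs with \<open>\<pi> = q\<close> itself.\<close>
lemma unramified_valuation:
  assumes q: "prime q" and z: "z ^ v = 1" "v > 0" and "v dvd q ^ j + 1" "j \<ge> 1"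
    and x: "x \<in> int_adjoin z" "x * cnj x = of_int N" and N: "int q ^ r dvd N"
  shows "dvd_adj z (of_nat q ^ ((r + 1) div 2)) x"
proof (rule half_valuation [OF z _ _ _ prime_power_ge_2 [OF q assms(5)] _ x(1)])
  fix y assume y: "y \<in> int_adjoin z"
  have "z ^ (q ^ j + 1) = 1" using assms(4) z by (elim dvdE) (simp only: power_mult power_one)
  then show "dvd_adj z (of_nat q) (y ^ q ^ j - cnj y)"
    by (intro frobenius_cong_cnj [OF q z _ _ y]) simp_all
next
  show "dvd_adj z (of_nat q ^ r) (x * cnj x)" unfolding x(2) by (rule dvd_adj_of_int_power [OF N])
qed (use q in \<open>auto simp: prime_gt_0_nat\<close>)

text \<open>For odd \<open>r\<close> rounding up would produce the factor \<open>q ^ (r + 1)\<close> in the norm.\<close>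
lemma unramified_even:
  assumes "prime q" "z ^ v = 1" "v > 0" "v dvd q ^ j + 1" "j \<ge> 1"
    and "x \<in> int_adjoin z" "x * cnj x = of_int N" "exact_power_dvd q r N"
  shows "even r"
proof (rule ccontr)
  assume "odd r"
  then have "2 * ((r + 1) div 2) = r + 1" by simp
  moreover have "int q ^ (2 * ((r + 1) div 2)) dvd N"
    using assms by (intro dvd_norm_from_dvd_adj [OF assms(1-3,7)] unramified_valuation [OF assms(1-7)])
      (simp add: exact_power_dvd_def)
  ultimately show False using assms(8) by (simp add: exact_power_dvd_def)
qed

text \<open>Here \<open>\<pi> = 1 - z ^ w\<close>, whose power with exponent \<open>q ^ e * (q - 1)\<close> is associated to \<open>q\<close>.\<close>
lemma ramified_valuation:
  assumes q: "prime q" and v: "v = q ^ Suc e * w" and z: "primitive_root_of_unity v z"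
    and j: "w dvd q ^ j + 1" "j \<ge> 1"
    and x: "x \<in> int_adjoin z" "x * cnj x = of_int N" and N: "int q ^ r dvd N"
  shows "dvd_adj z ((1 - z ^ w) ^ ((q ^ e * (q - 1) * r + 1) div 2)) x"
proof -
  define \<alpha> where "\<alpha> = z ^ w"
  define \<pi> where "\<pi> = 1 - \<alpha>"
  have z1: "z ^ v = 1" "v > 0" using z unfolding primitive_root_of_unity_def by auto
  have w: "w > 0" using z1(2) v by (cases w) auto
  have \<alpha>: "primitive_root_of_unity (q ^ Suc e) \<alpha>"
    unfolding \<alpha>_def using primitive_root_power [of w "q ^ Suc e" z] z w by (simp add: v mult.commute)
  have \<alpha>z: "\<alpha> \<in> int_adjoin z" unfolding \<alpha>_def by auto
  have q1: "q ^ Suc e > 1" using prime_power_ge_2 [OF q, of "Suc e"] by simp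
  have \<alpha>1: "\<alpha> ^ q ^ Suc e = 1" "q ^ Suc e > 0" using \<alpha> unfolding primitive_root_of_unity_def by auto
  have "\<alpha> \<noteq> 1"
    using primitive_root_power_eq_1_iff [OF \<alpha>, of 1] q1 by auto
  then have \<pi>0: "\<pi> \<noteq> 0" by (simp add: \<pi>_def)
  have \<pi>z: "\<pi> \<in> int_adjoin z" unfolding \<pi>_def using \<alpha>z by auto
  have pq: "dvd_adj z (\<pi> ^ (q ^ e * (q - 1))) (of_nat q)"
    unfolding \<pi>_def by (rule dvd_adj_subset [OF prime_associated_power(1) [OF q \<alpha>] \<alpha>z])
  have phi: "q ^ e * (q - 1) \<ge> 1" using prime_gt_1_nat [OF q] by simp
  have "dvd_adj z (\<pi> ^ 1) (\<pi> ^ (q ^ e * (q - 1)))" by (rule dvd_adj_power_le [OF \<pi>z phi])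
  then have \<pi>q: "dvd_adj z \<pi> (of_nat q)" using dvd_adj_trans [OF _ pq] by simp
  show ?thesis unfolding \<alpha>_def [symmetric] \<pi>_def [symmetric]
  proof (rule half_valuation [OF z1 \<pi>z \<pi>0 _ prime_power_ge_2 [OF q j(2)] _ x(1)])
    have "\<pi> = cnj \<pi> * (- \<alpha>)"
      using root_of_unity_mult_cnj [OF \<alpha>1] by (simp add: \<pi>_def algebra_simps)
    then show "dvd_adj z (cnj \<pi>) \<pi>" by (rule dvd_adjI [rotated]) (use \<alpha>z in auto)
  next
    fix y assume y: "y \<in> int_adjoin z"
    \<comment> \<open>\<open>z ^ (q ^ j + 1)\<close> is a power of \<open>z ^ w\<close>, hence \<open>1\<close> modulo \<open>\<pi>\<close>\<close>
    obtain l where "q ^ j + 1 = w * l" using j(1) by (rule dvdE)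
    then have "z ^ (q ^ j + 1) - 1 = \<alpha> ^ l - 1 ^ l" by (simp add: \<alpha>_def power_mult del: power_Suc)
    moreover have "dvd_adj z \<pi> (\<alpha> ^ l - 1 ^ l)"
    proof (rule dvd_adj_power_diff [OF \<alpha>z])
      show "dvd_adj z \<pi> (\<alpha> - 1)" using dvd_adj_uminus [OF dvd_adj_refl [of z \<pi>]] by (simp add: \<pi>_def)
    qed simp
    ultimately have "dvd_adj z \<pi> (z ^ (q ^ j + 1) - 1)" by simp
    then show "dvd_adj z \<pi> (y ^ q ^ j - cnj y)" by (rule frobenius_cong_cnj [OF q z1 \<pi>q _ y])
  next
    have "dvd_adj z ((\<pi> ^ (q ^ e * (q - 1))) ^ r) (of_nat q ^ r)" by (rule dvd_adj_power_mono [OF pq])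
    then show "dvd_adj z (\<pi> ^ (q ^ e * (q - 1) * r)) (x * cnj x)"
      unfolding x(2) power_mult by (rule dvd_adj_trans [OF _ dvd_adj_of_int_power [OF N]])
  qed
qed

text \<open>Both cases phrased in terms of \<open>q\<close> alone, at the price of rounding down.\<close>
lemma self_conjugate_valuation:
  assumes q: "prime q" and v: "v = q ^ e * w" and z: "primitive_root_of_unity v z"
    and j: "w dvd q ^ j + 1" "j \<ge> 1"
    and x: "x \<in> int_adjoin z" "x * cnj x = of_int N" and N: "int q ^ r dvd N"
  shows "dvd_adj z (of_nat q ^ (r div 2)) x"
proof (cases e)
  case 0
  have z1: "z ^ v = 1" "v > 0" using z unfolding primitive_root_of_unity_def by auto
  have "dvd_adj z (of_nat q ^ (r div 2)) (of_nat q ^ ((r + 1) div 2))"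
    by (rule dvd_adj_power_le) auto
  then show ?thesis
    by (rule dvd_adj_trans) (rule unramified_valuation [OF q z1 _ j(2) x N], use j v 0 in simp)
next
  case (Suc e')
  let ?\<pi> = "1 - z ^ w" and ?f = "q ^ e' * (q - 1)"
  have z1: "z ^ v = 1" "v > 0" using z unfolding primitive_root_of_unity_def by auto
  have w: "w > 0" using z1(2) v by (cases w) auto
  have \<alpha>: "primitive_root_of_unity (q ^ Suc e') (z ^ w)"
    using primitive_root_power [of w "q ^ Suc e'" z] z w by (simp add: v Suc mult.commute)
  have \<pi>z: "?\<pi> \<in> int_adjoin z" by auto
  have "dvd_adj z (of_nat q) (?\<pi> ^ ?f)"
    by (rule dvd_adj_subset [OF prime_associated_power(2) [OF q \<alpha>]]) auto
  then have "dvd_adj z (of_nat q ^ (r div 2)) ((?\<pi> ^ ?f) ^ (r div 2))" by (rule dvd_adj_power_mono)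
  moreover have "dvd_adj z ((?\<pi> ^ ?f) ^ (r div 2)) (?\<pi> ^ ((?f * r + 1) div 2))"
    unfolding power_mult [symmetric]
  proof (rule dvd_adj_power_le [OF \<pi>z])
    have "?f * (r div 2) * 2 \<le> ?f * r" by (simp add: mult.assoc)
    then show "?f * (r div 2) \<le> (?f * r + 1) div 2" by linarith
  qed
  moreover have "dvd_adj z (?\<pi> ^ ((?f * r + 1) div 2)) x"
    by (rule ramified_valuation [OF q _ z j x N]) (simp add: v Suc)
  ultimately show ?thesis by (metis dvd_adj_trans)
qed

section \<open>Expansions in powers of a root of prime power order\<close>

text \<open>Substituting \<open>\<alpha> = 1 - \<pi>\<close> turns the sum into one over powers of \<open>\<pi>\<close>, whose coefficients are up to sign the
  binomial sums of the conclusion. Comparing \<open>\<pi>\<close>-adically, a coefficient that is the first one not known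
  to be a multiple of \<open>q\<close> is a multiple of \<open>\<pi>\<close>, and by \<open>saturation\<close> a multiple of \<open>\<pi>\<close> that comes from
  the unramified ring \<open>\<int>[y]\<close> is a multiple of \<open>q\<close>.\<close>
lemma binomial_sums_dvd:
  assumes q: "prime q" "coprime q w" and y: "y ^ w = 1" "w > 0" and z: "z ^ v = 1" "v > 0"
    and \<alpha>: "primitive_root_of_unity (q ^ Suc e) \<alpha>" "\<alpha> \<in> int_adjoin z" and yz: "y \<in> int_adjoin z"
    and c: "\<And>j. j < M \<Longrightarrow> c j \<in> int_adjoin y"
    and s: "s \<le> q ^ e * (q - 1)" and d: "dvd_adj z ((1 - \<alpha>) ^ s) (\<Sum>j<M. c j * \<alpha> ^ j)"
    and i: "i < s"
  shows "dvd_adj y (of_nat q) (\<Sum>j<M. of_nat (j choose i) * c j)"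
proof -
  define \<pi> where "\<pi> = 1 - \<alpha>"
  define \<phi> where "\<phi> = q ^ e * (q - 1)"
  define E where "E i = (\<Sum>j<M. of_nat (j choose i) * c j)" for i
  have \<pi>z: "\<pi> \<in> int_adjoin z" unfolding \<pi>_def using \<alpha>(2) by (intro int_adjoin_diff) auto
  have q1: "q ^ Suc e > 1" using prime_power_ge_2 [OF q(1), of "Suc e"] by simp
  have "\<alpha> \<noteq> 1" using primitive_root_power_eq_1_iff [OF \<alpha>(1), of 1] q1 by auto
  then have \<pi>0: "\<pi> \<noteq> 0" by (simp add: \<pi>_def)
  have pq: "dvd_adj z (\<pi> ^ \<phi>) (of_nat q)"
    unfolding \<pi>_def \<phi>_def by (rule dvd_adj_subset [OF prime_associated_power(1) [OF q(1) \<alpha>(1)] \<alpha>(2)])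
  have qp: "dvd_adj z (of_nat q) (\<pi> ^ \<phi>)"
    unfolding \<pi>_def \<phi>_def by (rule dvd_adj_subset [OF prime_associated_power(2) [OF q(1) \<alpha>(1)] \<alpha>(2)])
  have \<phi>0: "\<phi> > 0" using prime_gt_1_nat [OF q(1)] by (simp add: \<phi>_def)
  have E: "E i \<in> int_adjoin y" for i
    unfolding E_def by (intro int_adjoin_sum int_adjoin_mult) (use c in auto)
  have Ez: "E i \<in> int_adjoin z" for i using E int_adjoin_subset [OF yz] by blast
  have "(\<Sum>j<M. c j * \<alpha> ^ j) = (\<Sum>j<M. \<Sum>i<M. of_nat (j choose i) * c j * (- \<pi>) ^ i)"
  proof (rule sum.cong)
    fix j assume "j \<in> {..<M}"
    have "\<alpha> ^ j = (- \<pi> + 1) ^ j" by (simp add: \<pi>_def)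
    also have "\<dots> = (\<Sum>i\<le>j. of_nat (j choose i) * (- \<pi>) ^ i)" unfolding binomial_ring by simp
    also have "\<dots> = (\<Sum>i<M. of_nat (j choose i) * (- \<pi>) ^ i)"
      using \<open>j \<in> {..<M}\<close> by (intro sum.mono_neutral_left) (auto simp: not_le binomial_eq_0)
    finally have "\<alpha> ^ j = (\<Sum>i<M. of_nat (j choose i) * (- \<pi>) ^ i)" .
    then show "c j * \<alpha> ^ j = (\<Sum>i<M. of_nat (j choose i) * c j * (- \<pi>) ^ i)"
      by (simp only: sum_distrib_left) (simp add: mult_ac)
  qed simp
  also have "\<dots> = (\<Sum>i<M. E i * (- \<pi>) ^ i)"
    unfolding E_def sum_distrib_right by (rule sum.swap)
  finally have exp: "(\<Sum>j<M. c j * \<alpha> ^ j) = (\<Sum>i<M. E i * (- \<pi>) ^ i)" .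
  have "dvd_adj y (of_nat q) (E i)" using i
  proof (induction i rule: less_induct)
    case (less i)
    show ?case
    proof (cases "i < M")
      case False
      then have "E i = 0" unfolding E_def by (intro sum.neutral) (auto simp: binomial_eq_0)
      then show ?thesis by simp
    next
      case True
      have "{..<M} = {..<i} \<union> ({i} \<union> {Suc i..<M})" using True by auto
      then have "(\<Sum>j<M. c j * \<alpha> ^ j) = (\<Sum>k<i. E k * (- \<pi>) ^ k)
          + (E i * (- \<pi>) ^ i + (\<Sum>k\<in>{Suc i..<M}. E k * (- \<pi>) ^ k))"
        unfolding exp by (simp only:) (subst sum.union_disjoint, simp, simp, force,
            subst sum.union_disjoint, simp_all)
      then have eq: "E i * (- \<pi>) ^ i = (\<Sum>j<M. c j * \<alpha> ^ j)
          - ((\<Sum>k<i. E k * (- \<pi>) ^ k) + (\<Sum>k\<in>{Suc i..<M}. E k * (- \<pi>) ^ k))"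
        by simp
      have pik: "(- \<pi>) ^ k \<in> int_adjoin z" for k using \<pi>z by auto
      have "dvd_adj z (\<pi> ^ Suc i) (\<Sum>j<M. c j * \<alpha> ^ j)"
        using less.prems d [folded \<pi>_def]
        by (intro dvd_adj_trans [OF dvd_adj_power_le [OF \<pi>z, of "Suc i" s]]) simp_all
      moreover have "dvd_adj z (\<pi> ^ Suc i) (\<Sum>k<i. E k * (- \<pi>) ^ k)"
      proof (intro dvd_adj_sum dvd_adj_mult pik)
        fix k assume "k \<in> {..<i}"
        then have "dvd_adj y (of_nat q) (E k)" using less by simp
        then have 1: "dvd_adj z (of_nat q) (E k)" by (rule dvd_adj_subset [OF _ yz])
        have "dvd_adj z (\<pi> ^ Suc i) (\<pi> ^ \<phi>)"
          using less.prems s by (intro dvd_adj_power_le [OF \<pi>z]) (simp add: \<phi>_def)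
        then show "dvd_adj z (\<pi> ^ Suc i) (E k)" using pq 1 by (metis dvd_adj_trans)
      qed
      moreover have "dvd_adj z (\<pi> ^ Suc i) (\<Sum>k\<in>{Suc i..<M}. E k * (- \<pi>) ^ k)"
      proof (intro dvd_adj_sum dvd_adj_mult2 Ez)
        fix k assume "k \<in> {Suc i..<M}"
        then have "dvd_adj z (\<pi> ^ Suc i) (\<pi> ^ k)" by (intro dvd_adj_power_le [OF \<pi>z]) simp
        then have "dvd_adj z (\<pi> ^ Suc i) (\<pi> ^ k * (- 1) ^ k)"
          by (rule dvd_adj_mult) (metis int_adjoin_1 int_adjoin_power int_adjoin_uminus)
        then show "dvd_adj z (\<pi> ^ Suc i) ((- \<pi>) ^ k)" by (simp add: power_mult_distrib [symmetric])
      qed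
      ultimately have "dvd_adj z (\<pi> ^ Suc i) (E i * (- \<pi>) ^ i)"
        unfolding eq by (intro dvd_adj_diff dvd_adj_add)
      then have "dvd_adj z (\<pi> ^ Suc i) ((E i * (- \<pi>) ^ i) * (- 1) ^ i)"
        by (rule dvd_adj_mult) (metis int_adjoin_1 int_adjoin_power int_adjoin_uminus)
      moreover have "(E i * (- \<pi>) ^ i) * (- 1) ^ i = \<pi> ^ i * E i"
        by (simp add: power_mult_distrib [symmetric] mult.assoc mult.commute)
      moreover have "\<pi> ^ Suc i = \<pi> ^ i * \<pi>" by simp
      ultimately have "dvd_adj z (\<pi> ^ i * \<pi>) (\<pi> ^ i * E i)" by (simp only:)
      then have "dvd_adj z \<pi> (E i)" using dvd_adj_cancel [of "\<pi> ^ i" z \<pi> "E i"] \<pi>0 by simp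
      then have "dvd_adj z (\<pi> ^ \<phi>) (E i ^ \<phi>)" by (rule dvd_adj_power_mono)
      then have "dvd_adj z (of_nat q) (E i ^ \<phi>)" by (rule dvd_adj_trans [OF qp])
      then show ?thesis by (rule saturation [OF q y z E _ \<phi>0])
    qed
  qed
  then show ?thesis unfolding E_def .
qed

text \<open>The powers of \<open>\<alpha>\<close> with exponent below \<open>q ^ e * (q - 1)\<close> are independent modulo every power of \<open>q\<close>: the
  passage from coefficients to binomial sums is unitriangular, so it can be undone.\<close>
lemma coefficients_dvd:
  assumes q: "prime q" "coprime q w" and y: "y ^ w = 1" "w > 0" and z: "z ^ v = 1" "v > 0"
    and \<alpha>: "primitive_root_of_unity (q ^ Suc e) \<alpha>" "\<alpha> \<in> int_adjoin z" and yz: "y \<in> int_adjoin z"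
    and c: "\<And>j. j < q ^ e * (q - 1) \<Longrightarrow> c j \<in> int_adjoin y"
    and d: "dvd_adj z (of_nat q ^ a) (\<Sum>j<q ^ e * (q - 1). c j * \<alpha> ^ j)"
    and j: "j < q ^ e * (q - 1)"
  shows "dvd_adj y (of_nat q ^ a) (c j)"
  using c d j
proof (induction a arbitrary: c j)
  case 0
  then show ?case by (simp add: dvd_adj_one_left)
next
  case (Suc a)
  let ?\<phi> = "q ^ e * (q - 1)"
  have q0: "of_nat q \<noteq> (0 :: complex)" using q(1) by auto
  have "dvd_adj z ((1 - \<alpha>) ^ ?\<phi>) (of_nat q)"
    by (rule dvd_adj_subset [OF prime_associated_power(1) [OF q(1) \<alpha>(1)] \<alpha>(2)])
  moreover have "dvd_adj z (of_nat q) (of_nat q ^ Suc a)"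
    using dvd_adj_power_le [of "of_nat q" z 1 "Suc a"] by simp
  ultimately have d\<phi>: "dvd_adj z ((1 - \<alpha>) ^ ?\<phi>) (\<Sum>j<?\<phi>. c j * \<alpha> ^ j)"
    using Suc.prems(2) by (metis dvd_adj_trans)
  have E: "dvd_adj y (of_nat q) (\<Sum>k<?\<phi>. of_nat (k choose i) * c k)" if "i < ?\<phi>" for i
    by (rule binomial_sums_dvd [OF q y z \<alpha> yz Suc.prems(1) order_refl d\<phi> that])
  have cq: "dvd_adj y (of_nat q) (c j)" if "j < ?\<phi>" for j
    using that
  proof (induction "?\<phi> - j" arbitrary: j rule: less_induct)
    case less
    have "(\<Sum>k<?\<phi>. of_nat (k choose j) * c k) = (\<Sum>k\<in>{j<..<?\<phi>}. of_nat (k choose j) * c k) + c j"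
    proof -
      have "(\<Sum>k<?\<phi>. of_nat (k choose j) * c k) = (\<Sum>k\<in>insert j {j<..<?\<phi>}. of_nat (k choose j) * c k)"
        using less.prems by (intro sum.mono_neutral_right) (auto simp: not_less binomial_eq_0 le_less)
      then show ?thesis by simp
    qed
    moreover have "dvd_adj y (of_nat q) (\<Sum>k\<in>{j<..<?\<phi>}. of_nat (k choose j) * c k)"
      by (intro dvd_adj_sum dvd_adj_mult2 less.hyps) auto
    ultimately have "dvd_adj y (of_nat q) ((\<Sum>k\<in>{j<..<?\<phi>}. of_nat (k choose j) * c k) + c j
        - (\<Sum>k\<in>{j<..<?\<phi>}. of_nat (k choose j) * c k))"
      using E [OF less.prems] by (intro dvd_adj_diff) simp_all
    then show ?case by simp
  qed
  then have "\<forall>j. \<exists>x. j < ?\<phi> \<longrightarrow> x \<in> int_adjoin y \<and> c j = of_nat q * x" by (meson dvd_adjE)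
  then obtain c' where c': "\<And>j. j < ?\<phi> \<Longrightarrow> c' j \<in> int_adjoin y" "\<And>j. j < ?\<phi> \<Longrightarrow> c j = of_nat q * c' j"
    by metis
  have "(\<Sum>j<?\<phi>. c j * \<alpha> ^ j) = of_nat q * (\<Sum>j<?\<phi>. c' j * \<alpha> ^ j)"
    unfolding sum_distrib_left by (intro sum.cong) (simp_all add: c'(2))
  then have "dvd_adj z (of_nat q ^ a) (\<Sum>j<?\<phi>. c' j * \<alpha> ^ j)"
    using Suc.prems(2) dvd_adj_cancel [OF q0, of z "of_nat q ^ a"] by simp
  with c'(1) Suc.prems(3) have "dvd_adj y (of_nat q ^ a) (c' j)" by (intro Suc.IH)
  then show ?case using dvd_adj_cancel [OF q0, of y "of_nat q ^ a" "c' j"] c'(2) [OF Suc.prems(3)] by simp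
qed

lemma sum_periodic_shift:
  fixes h :: "nat \<Rightarrow> 'a :: ab_group_add"
  assumes "\<And>i. h (i + n) = h i"
  shows "(\<Sum>i<n. h (i + s)) = (\<Sum>i<n. h i)"
proof (induction s)
  case (Suc s)
  have "h s + (\<Sum>i<n. h (Suc i + s)) = (\<Sum>i<Suc n. h (i + s))"
    unfolding sum.lessThan_Suc_shift by simp
  also have "\<dots> = (\<Sum>i<n. h (i + s)) + h s" using assms [of s] by (simp add: add.commute)
  finally show ?case using Suc by simp
qed simp

text \<open>Shifting the summation index by \<open>t\<close> multiplies the sum by \<open>\<alpha> ^ t \<noteq> 1\<close>.\<close>
lemma periodic_coefficients_sum_eq_0:
  fixes \<alpha> :: complex
  assumes "\<alpha> ^ n = 1" "\<alpha> ^ t \<noteq> 1" "\<And>i. h (i + n) = h i" "\<And>i. h (i + t) = h i"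
  shows "(\<Sum>i<n. h i * \<alpha> ^ i) = 0"
proof -
  have "(\<Sum>i<n. h i * \<alpha> ^ i) = (\<Sum>i<n. h (i + t) * \<alpha> ^ (i + t))"
    by (rule sum_periodic_shift [symmetric]) (simp add: assms(1,3) power_add)
  also have "\<dots> = \<alpha> ^ t * (\<Sum>i<n. h i * \<alpha> ^ i)"
    unfolding sum_distrib_left by (simp add: assms(4) power_add algebra_simps)
  finally have "(1 - \<alpha> ^ t) * (\<Sum>i<n. h i * \<alpha> ^ i) = 0" by (simp add: algebra_simps)
  then show ?thesis using assms(2) by simp
qed

text \<open>With all \<open>q ^ Suc e\<close> powers of \<open>\<alpha>\<close>, the only relations come from coefficients that are periodic with
  period \<open>q ^ e\<close>. Hence differences of coefficients with indices congruent modulo \<open>q ^ e\<close> are determined.\<close>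
lemma coefficient_differences_dvd:
  assumes q: "prime q" "coprime q w" and y: "y ^ w = 1" "w > 0" and z: "z ^ v = 1" "v > 0"
    and \<alpha>: "primitive_root_of_unity (q ^ Suc e) \<alpha>" "\<alpha> \<in> int_adjoin z" and yz: "y \<in> int_adjoin z"
    and c: "\<And>j. j < q ^ Suc e \<Longrightarrow> c j \<in> int_adjoin y"
    and d: "dvd_adj z (of_nat q ^ a) (\<Sum>j<q ^ Suc e. c j * \<alpha> ^ j)"
    and ij: "i < q ^ Suc e" "j < q ^ Suc e" "i mod q ^ e = j mod q ^ e"
  shows "dvd_adj y (of_nat q ^ a) (c i - c j)"
proof -
  let ?t = "q ^ e" and ?\<phi> = "q ^ e * (q - 1)"
  \<comment> \<open>the periodic sequence that agrees with \<open>c\<close> on the top block; subtracting it leaves only exponents below \<open>?\<phi>\<close>\<close>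
  define T where "T j = c (?\<phi> + j mod ?t)" for j
  have q1: "q > 1" using prime_gt_1_nat [OF q(1)] .
  have t: "?t > 0" using q1 by simp
  have n: "q ^ Suc e = ?\<phi> + ?t" using q1 by (simp add: algebra_simps)
  have Ty: "T j \<in> int_adjoin y" for j unfolding T_def n [symmetric]
    by (intro c) (unfold n, use t in simp)
  have "(\<Sum>j<q ^ Suc e. T j * \<alpha> ^ j) = 0"
  proof (rule periodic_coefficients_sum_eq_0 [where t = ?t])
    show "\<alpha> ^ q ^ Suc e = 1" using \<alpha>(1) unfolding primitive_root_of_unity_def by simp
    show "\<alpha> ^ ?t \<noteq> 1" unfolding primitive_root_power_eq_1_iff [OF \<alpha>(1)] using q1 by (auto dest: dvd_imp_le)
    show "T (i + q ^ Suc e) = T i" for i unfolding T_def by simp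
    show "T (i + ?t) = T i" for i unfolding T_def by simp
  qed
  then have "(\<Sum>j<q ^ Suc e. c j * \<alpha> ^ j) = (\<Sum>j<q ^ Suc e. (c j - T j) * \<alpha> ^ j)"
    by (simp add: left_diff_distrib sum_subtractf)
  also have "\<dots> = (\<Sum>j<?\<phi>. (c j - T j) * \<alpha> ^ j)"
  proof (rule sum.mono_neutral_right)
    show "\<forall>j\<in>{..<q ^ Suc e} - {..<?\<phi>}. (c j - T j) * \<alpha> ^ j = 0"
    proof
      fix j assume j: "j \<in> {..<q ^ Suc e} - {..<?\<phi>}"
      then have "j = ?\<phi> + (j - ?\<phi>)" "j - ?\<phi> < ?t" unfolding n by auto
      then have "j mod ?t = j - ?\<phi>" by (metis mod_less mod_mult_self4 mult.commute)
      then have "T j = c j" using j unfolding T_def by simp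
      then show "(c j - T j) * \<alpha> ^ j = 0" by simp
    qed
  qed (auto simp: n)
  finally have s: "dvd_adj z (of_nat q ^ a) (\<Sum>j<?\<phi>. (c j - T j) * \<alpha> ^ j)" using d by simp
  have cT: "dvd_adj y (of_nat q ^ a) (c j - T j)" if "j < q ^ Suc e" for j
  proof (cases "j < ?\<phi>")
    case True
    show ?thesis
      by (rule coefficients_dvd [OF q y z \<alpha> yz _ s True]) (intro int_adjoin_diff Ty c, unfold n, simp)
  next
    case False
    then have "j = ?\<phi> + (j - ?\<phi>)" "j - ?\<phi> < ?t" using that unfolding n by auto
    then have "j mod ?t = j - ?\<phi>" by (metis mod_less mod_mult_self4 mult.commute)
    then have "T j = c j" using False unfolding T_def by simp
    then show ?thesis by simp
  qed
  have "dvd_adj y (of_nat q ^ a) ((c i - T i) - (c j - T j))"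
    by (rule dvd_adj_diff [OF cT [OF ij(1)] cT [OF ij(2)]])
  moreover have "T i = T j" unfolding T_def ij(3) ..
  ultimately show ?thesis by simp
qed

section \<open>Character sums of nearly perfect sequences\<close>

lemma p_ary_entry_power:
  assumes "p_ary_sequence p n a"
  shows "a i ^ p = 1"
proof -
  from assms obtain \<zeta> b where "primitive_root_of_unity p \<zeta>" "a i = \<zeta> powi (b :: int)"
    unfolding p_ary_sequence_def by blast
  then have \<zeta>: "\<zeta> ^ p = 1" "a i = \<zeta> powi b" unfolding primitive_root_of_unity_def by auto
  have "a i ^ p = \<zeta> powi (int p * b)"
    unfolding \<zeta>(2) by (metis power_int_mult power_int_of_nat mult.commute)
  also have "\<dots> = 1" using \<zeta>(1) by (simp add: power_int_mult)
  finally show ?thesis .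
qed

text \<open>Expanding the product and collecting the pairs of indices with difference \<open>t\<close> gives the Fourier transform
  of the autocorrelation function, which is \<open>n\<close> at \<open>0\<close> and \<open>\<gamma>\<close> elsewhere.\<close>
lemma character_norm:
  assumes a: "nearly_perfect_sequence p n \<gamma> a" and p: "p > 0" and n: "n > 0" and \<theta>: "\<theta> ^ n = 1"
  shows "(\<Sum>i<n. a i * \<theta> ^ i) * cnj (\<Sum>i<n. a i * \<theta> ^ i)
    = of_int (if \<theta> = 1 then (\<gamma> + 1) * int n - \<gamma> else int n - \<gamma>)"
proof -
  have seq: "p_ary_sequence p n a" using a unfolding nearly_perfect_sequence_def by simp
  have per: "a (i + n) = a i" for i using seq unfolding p_ary_sequence_def by simp
  have unit: "a i * cnj (a i) = 1" for i
    by (rule root_of_unity_mult_cnj [OF p_ary_entry_power [OF seq] p])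
  have \<theta>1: "\<theta> ^ i * cnj (\<theta> ^ i) = 1" for i
    using root_of_unity_mult_cnj [OF \<theta> n] by (simp add: power_mult_distrib [symmetric])
  have C0: "autocorrelation n a 0 = of_nat n" unfolding autocorrelation_def by (simp add: unit)
  have C: "autocorrelation n a t = of_int \<gamma>" if "t \<in> {1..<n}" for t
    using a that unfolding nearly_perfect_sequence_def by auto
  have "(\<Sum>i<n. a i * \<theta> ^ i) * cnj (\<Sum>i<n. a i * \<theta> ^ i)
      = (\<Sum>i<n. a i * \<theta> ^ i * (\<Sum>k<n. cnj (a k * \<theta> ^ k)))"
    by (simp add: sum_distrib_right)
  also have "\<dots> = (\<Sum>i<n. \<Sum>t<n. a i * cnj (a (i + t)) * cnj (\<theta> ^ t))"
  proof (rule sum.cong)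
    fix i
    have "(\<Sum>k<n. cnj (a k * \<theta> ^ k)) = (\<Sum>t<n. cnj (a (t + i) * \<theta> ^ (t + i)))"
      by (rule sum_periodic_shift [symmetric]) (simp add: per power_add \<theta>)
    then have "a i * \<theta> ^ i * (\<Sum>k<n. cnj (a k * \<theta> ^ k))
        = (\<Sum>t<n. (\<theta> ^ i * cnj (\<theta> ^ i)) * (a i * cnj (a (i + t)) * cnj (\<theta> ^ t)))"
      by (simp add: sum_distrib_left power_add mult_ac add.commute)
    then show "a i * \<theta> ^ i * (\<Sum>k<n. cnj (a k * \<theta> ^ k)) = (\<Sum>t<n. a i * cnj (a (i + t)) * cnj (\<theta> ^ t))"
      by (simp only: \<theta>1 mult_1)
  qed simp
  also have "\<dots> = (\<Sum>t<n. autocorrelation n a t * cnj (\<theta> ^ t))"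
    unfolding autocorrelation_def sum_distrib_right by (rule sum.swap)
  also have "\<dots> = autocorrelation n a 0 + (\<Sum>t\<in>{1..<n}. autocorrelation n a t * cnj (\<theta> ^ t))"
    using n by (simp add: lessThan_atLeast0 sum.atLeast_Suc_lessThan)
  also have "\<dots> = of_nat n - of_int \<gamma> + of_int \<gamma> * (1 + (\<Sum>t\<in>{1..<n}. cnj (\<theta> ^ t)))"
    by (simp add: C C0 sum_distrib_left algebra_simps)
  also have "1 + (\<Sum>t\<in>{1..<n}. cnj (\<theta> ^ t)) = cnj (\<Sum>t<n. \<theta> ^ t)"
    using n by (simp add: lessThan_atLeast0 sum.atLeast_Suc_lessThan)
  also have "(\<Sum>t<n. \<theta> ^ t) = (if \<theta> = 1 then of_nat n else 0)"
    using root_of_unity_sum_eq_0 [OF \<theta>] by simp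
  finally show ?thesis by (cases "\<theta> = 1") (simp_all add: algebra_simps)
qed

text \<open>The coefficient at \<open>k\<close> of the image of the sequence in the group ring of \<open>\<int>/u\<int>\<close>. Reducing \<open>k\<close> modulo
  \<open>u\<close> in the definition makes it periodic in \<open>k\<close>, so that shifts need no reduction.\<close>
definition class_sum :: "(nat \<Rightarrow> complex) \<Rightarrow> nat \<Rightarrow> nat \<Rightarrow> nat \<Rightarrow> complex" where
  "class_sum a n u k = (\<Sum>i | i < n \<and> i mod u = k mod u. a i)"

lemma power_mod_order: "x ^ m = 1 \<Longrightarrow> x ^ (k mod m) = (x :: complex) ^ k"
proof -
  assume x: "x ^ m = 1"
  have "x ^ k = x ^ (m * (k div m) + k mod m)" by simp
  also have "\<dots> = x ^ (k mod m)" unfolding power_add power_mult using x by simp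
  finally show ?thesis by simp
qed

lemma sum_group_mod:
  fixes f :: "nat \<Rightarrow> 'a :: comm_monoid_add"
  assumes "m > 0" "finite K"
  shows "(\<Sum>k\<in>K. f k) = (\<Sum>i<m. \<Sum>k | k \<in> K \<and> k mod m = i. f k)"
  by (rule sum.group [symmetric]) (use assms in auto)

lemma character_via_class_sums:
  assumes "u > 0" "\<theta> ^ u = 1"
  shows "(\<Sum>i<n. a i * \<theta> ^ i) = (\<Sum>k<u. class_sum a n u k * \<theta> ^ k)"
proof -
  have "(\<Sum>i<n. a i * \<theta> ^ i) = (\<Sum>k<u. \<Sum>i | i \<in> {..<n} \<and> i mod u = k. a i * \<theta> ^ i)"
    by (rule sum_group_mod) (use assms in auto)
  also have "\<dots> = (\<Sum>k<u. class_sum a n u k * \<theta> ^ k)"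
  proof (rule sum.cong)
    fix k assume k: "k \<in> {..<u}"
    have "(\<Sum>i | i \<in> {..<n} \<and> i mod u = k. a i * \<theta> ^ i)
        = (\<Sum>i | i < n \<and> i mod u = k mod u. a i * \<theta> ^ k)"
    proof (rule sum.cong)
      fix i assume "i \<in> {i. i < n \<and> i mod u = k mod u}"
      then have "i mod u = k" using k by simp
      then show "a i * \<theta> ^ i = a i * \<theta> ^ k" using power_mod_order [OF assms(2), of i] by simp
    qed (use k in auto)
    then show "(\<Sum>i | i \<in> {..<n} \<and> i mod u = k. a i * \<theta> ^ i) = class_sum a n u k * \<theta> ^ k"
      unfolding class_sum_def sum_distrib_right .
  qed simp
  finally show ?thesis .
qed

section \<open>Divisibility of class sums by Fourier inversion\<close>

text \<open>Fourier inversion on the cyclic group of order \<open>m\<close>, for sums over an arbitrary index set: summing against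
  the conjugates of all characters isolates a residue class of indices.\<close>
lemma fourier_extract:
  assumes "primitive_root_of_unity m \<beta>" "finite K"
  shows "(\<Sum>l<m. (\<Sum>k\<in>K. f k * (\<beta> ^ l) ^ k) * cnj ((\<beta> ^ l) ^ k0))
    = of_nat m * (\<Sum>k | k \<in> K \<and> k mod m = k0 mod m. f k)"
proof -
  have m: "m > 0" "\<beta> ^ m = 1" using assms(1) unfolding primitive_root_of_unity_def by auto
  have nz: "\<beta> ^ i * cnj (\<beta> ^ i) = 1" for i
    using root_of_unity_mult_cnj [OF m(2,1)] by (simp add: power_mult_distrib [symmetric])
  have orth: "(\<Sum>l<m. (\<beta> ^ l) ^ k * cnj ((\<beta> ^ l) ^ k0)) = (if k mod m = k0 mod m then of_nat m else 0)" for k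
  proof -
    define \<rho> where "\<rho> = \<beta> ^ k * cnj (\<beta> ^ k0)"
    have "(\<Sum>l<m. (\<beta> ^ l) ^ k * cnj ((\<beta> ^ l) ^ k0)) = (\<Sum>l<m. \<rho> ^ l)"
      unfolding \<rho>_def by (simp add: power_mult_distrib power_mult [symmetric] mult.commute)
    moreover have "\<rho> = 1 \<longleftrightarrow> k mod m = k0 mod m"
    proof -
      have "\<rho> * \<beta> ^ k0 = \<beta> ^ k" unfolding \<rho>_def using nz [of k0] by (simp add: mult_ac)
      moreover have "\<beta> ^ k0 \<noteq> 0" using nz [of 1] by auto
      ultimately have "\<rho> = 1 \<longleftrightarrow> \<beta> ^ k = \<beta> ^ k0" by auto
      also have "\<dots> \<longleftrightarrow> \<beta> ^ (k mod m) = \<beta> ^ (k0 mod m)" unfolding power_mod_order [OF m(2)] ..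
      also have "\<dots> \<longleftrightarrow> k mod m = k0 mod m"
        using inj_onD [OF primitive_root_power_inj [OF assms(1)], of "k mod m" "k0 mod m"] m(1) by auto
      finally show ?thesis .
    qed
    moreover have "\<rho> ^ m = 1"
      unfolding \<rho>_def power_mult_distrib complex_cnj_power [symmetric] power_mult [symmetric]
      using m(2) by (simp add: mult.commute [of _ m] power_mult)
    ultimately show ?thesis using root_of_unity_sum_eq_0 [of \<rho> m] by auto
  qed
  have "(\<Sum>l<m. (\<Sum>k\<in>K. f k * (\<beta> ^ l) ^ k) * cnj ((\<beta> ^ l) ^ k0))
      = (\<Sum>k\<in>K. \<Sum>l<m. f k * ((\<beta> ^ l) ^ k * cnj ((\<beta> ^ l) ^ k0)))"
    unfolding sum_distrib_right by (subst sum.swap) (simp add: mult_ac)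
  also have "\<dots> = (\<Sum>k\<in>K. if k mod m = k0 mod m then of_nat m * f k else 0)"
    unfolding sum_distrib_left [symmetric] orth by (intro sum.cong) auto
  also have "\<dots> = (\<Sum>k | k \<in> K \<and> k mod m = k0 mod m. of_nat m * f k)"
    using assms(2) by (simp add: sum.inter_filter)
  finally show ?thesis by (simp add: sum_distrib_left)
qed

lemma dvd_adj_cancel_coprime:
  assumes "dvd_adj z c (of_nat m * x)" "dvd_adj z c (of_nat q ^ a)" "coprime m q" "x \<in> int_adjoin z"
  shows "dvd_adj z c x"
proof -
  have "coprime (int m) (int q ^ a)" using assms(3) by simp
  then obtain s t where "s * int m + t * int q ^ a = 1"
    using bezout_int [of "int m" "int q ^ a"] by (auto simp: coprime_iff_gcd_eq_1)
  then have "of_int (s * int m + t * int q ^ a) = (1 :: complex)" by simp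
  then have "x = (of_int (s * int m + t * int q ^ a)) * x" by simp
  then have "x = of_int s * (of_nat m * x) + of_nat q ^ a * (of_int t * x)"
    by (simp add: algebra_simps)
  moreover have "dvd_adj z c (of_int s * (of_nat m * x) + of_nat q ^ a * (of_int t * x))"
    by (intro dvd_adj_add dvd_adj_mult2 [OF assms(1)] dvd_adj_mult [OF assms(2)] int_adjoin_mult
        int_adjoin_of_int assms(4))
  ultimately show ?thesis by simp
qed

lemma root_of_unity_cnj_mem:
  assumes "z ^ v = 1" "v > 0" "x \<in> int_adjoin z"
  shows "cnj x \<in> int_adjoin z"
  by (rule int_adjoin_cnj [OF assms(1,2) root_of_unity_norm [OF assms(1,2)] assms(3)])

text \<open>Inversion divides by \<open>u\<close>, which is harmless for \<open>u\<close> coprime to \<open>q\<close>. In the difference of two coefficients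
  the trivial character, about which nothing is assumed, cancels.\<close>
lemma class_differences_dvd_coprime:
  assumes z: "z ^ v = 1" "v > 0" and \<theta>: "primitive_root_of_unity u \<theta>" "\<theta> \<in> int_adjoin z"
    and B: "\<And>k. k < u \<Longrightarrow> B k \<in> int_adjoin z" and q: "coprime u q" "dvd_adj z c (of_nat q ^ a)"
    and X: "\<And>x. x ^ u = 1 \<Longrightarrow> x \<noteq> 1 \<Longrightarrow> dvd_adj z c (\<Sum>k<u. B k * x ^ k)"
    and k: "k < u" "k' < u"
  shows "dvd_adj z c (B k - B k')"
proof (rule dvd_adj_cancel_coprime [OF _ q(2,1)])
  have u: "u > 0" "\<theta> ^ u = 1" using \<theta>(1) unfolding primitive_root_of_unity_def by auto
  let ?X = "\<lambda>l. \<Sum>k<u. B k * (\<theta> ^ l) ^ k"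
  have sol: "(\<Sum>l<u. ?X l * cnj ((\<theta> ^ l) ^ k)) = of_nat u * B k" if "k < u" for k
  proof -
    have "{k'. k' \<in> {..<u} \<and> k' mod u = k mod u} = {k}" using that by auto
    then show ?thesis using fourier_extract [OF \<theta>(1), of "{..<u}" B k] by simp
  qed
  have "of_nat u * (B k - B k') = (\<Sum>l<u. ?X l * (cnj ((\<theta> ^ l) ^ k) - cnj ((\<theta> ^ l) ^ k')))"
    by (simp add: right_diff_distrib sum_subtractf sol [OF k(1), symmetric] sol [OF k(2), symmetric])
  also have "dvd_adj z c \<dots>"
  proof (rule dvd_adj_sum)
    fix l assume l: "l \<in> {..<u}"
    show "dvd_adj z c (?X l * (cnj ((\<theta> ^ l) ^ k) - cnj ((\<theta> ^ l) ^ k')))"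
    proof (cases "l = 0")
      case False
      have "dvd_adj z c (?X l)"
      proof (rule X)
        show "(\<theta> ^ l) ^ u = 1" by (simp add: power_mult [symmetric] mult.commute [of l] power_mult u)
        show "\<theta> ^ l \<noteq> 1"
          unfolding primitive_root_power_eq_1_iff [OF \<theta>(1)] using l False by (auto dest: dvd_imp_le)
      qed
      then show ?thesis
        by (intro dvd_adj_mult int_adjoin_diff root_of_unity_cnj_mem [OF z] int_adjoin_power \<theta>(2))
    qed simp
  qed
  finally show "dvd_adj z c (of_nat u * (B k - B k'))" .
  show "B k - B k' \<in> int_adjoin z" using B k by (intro int_adjoin_diff)
qed

text \<open>Only the part \<open>m\<close> of \<open>u\<close> prime to \<open>q\<close> is inverted, using the characters \<open>\<alpha> * \<beta> ^ l\<close>. What remains is a sum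
  over powers of \<open>\<alpha>\<close> with coefficients indexed by residues modulo \<open>q ^ Suc e\<close>, to which
  \<open>coefficient_differences_dvd\<close> applies. By the Chinese remainder theorem each of the two coefficients
  compared consists of a single value of \<open>B\<close>.\<close>
lemma class_differences_dvd_ramified:
  assumes q: "prime q" "coprime q w" and y: "y ^ w = 1" "w > 0" and z: "z ^ v = 1" "v > 0"
    and \<alpha>: "primitive_root_of_unity (q ^ Suc e) \<alpha>" "\<alpha> \<in> int_adjoin z" and yz: "y \<in> int_adjoin z"
    and \<beta>: "primitive_root_of_unity m \<beta>" "\<beta> \<in> int_adjoin z" and u: "u = q ^ Suc e * m" "coprime q m"
    and B: "\<And>k. k < u \<Longrightarrow> B k \<in> int_adjoin y"
    and X: "\<And>l. dvd_adj z (of_nat q ^ a) (\<Sum>k<u. B k * (\<alpha> * \<beta> ^ l) ^ k)"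
    and k: "k1 < u" "k2 < u" "k1 mod m = k2 mod m" "k1 mod q ^ e = k2 mod q ^ e"
  shows "dvd_adj y (of_nat q ^ a) (B k1 - B k2)"
proof -
  let ?Q = "q ^ Suc e"
  define K where "K = {k. k \<in> {..<u} \<and> k mod m = k1 mod m}"
  define c where "c i = (\<Sum>k | k \<in> K \<and> k mod ?Q = i. B k)" for i
  have Q: "?Q > 0" using prime_gt_0_nat [OF q(1)] by simp
  have finK: "finite K" unfolding K_def by simp
  have Bz: "B k \<in> int_adjoin z" if "k < u" for k using B [OF that] int_adjoin_subset [OF yz] by blast
  have \<alpha>1: "\<alpha> ^ ?Q = 1" using \<alpha>(1) unfolding primitive_root_of_unity_def by simp
  have "dvd_adj z (of_nat q ^ a) (\<Sum>l<m. (\<Sum>k<u. B k * \<alpha> ^ k * (\<beta> ^ l) ^ k) * cnj ((\<beta> ^ l) ^ k1))"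
  proof (rule dvd_adj_sum, rule dvd_adj_mult)
    fix l
    show "dvd_adj z (of_nat q ^ a) (\<Sum>k<u. B k * \<alpha> ^ k * (\<beta> ^ l) ^ k)"
      using X [of l] by (simp add: power_mult_distrib mult_ac)
    show "cnj ((\<beta> ^ l) ^ k1) \<in> int_adjoin z"
      by (intro root_of_unity_cnj_mem [OF z] int_adjoin_power \<beta>(2))
  qed
  then have "dvd_adj z (of_nat q ^ a) (of_nat m * (\<Sum>k\<in>K. B k * \<alpha> ^ k))"
    unfolding fourier_extract [OF \<beta>(1) finite_lessThan] K_def .
  then have "dvd_adj z (of_nat q ^ a) (\<Sum>k\<in>K. B k * \<alpha> ^ k)"
  proof (rule dvd_adj_cancel_coprime [OF _ dvd_adj_refl])
    show "coprime m q" using u(2) by (simp add: coprime_commute)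
    show "(\<Sum>k\<in>K. B k * \<alpha> ^ k) \<in> int_adjoin z"
      by (intro int_adjoin_sum int_adjoin_mult int_adjoin_power \<alpha>(2) Bz) (simp add: K_def)
  qed
  also have "(\<Sum>k\<in>K. B k * \<alpha> ^ k) = (\<Sum>i<?Q. \<Sum>k | k \<in> K \<and> k mod ?Q = i. B k * \<alpha> ^ k)"
    by (rule sum_group_mod [OF Q finK])
  also have "\<dots> = (\<Sum>i<?Q. c i * \<alpha> ^ i)"
    unfolding c_def sum_distrib_right
    by (intro sum.cong) (auto simp del: power_Suc simp: power_mod_order [OF \<alpha>1])
  finally have d: "dvd_adj z (of_nat q ^ a) (\<Sum>i<?Q. c i * \<alpha> ^ i)" .
  have "dvd_adj y (of_nat q ^ a) (c (k1 mod ?Q) - c (k2 mod ?Q))"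
  proof (rule coefficient_differences_dvd [OF q y z \<alpha> yz _ d])
    show "c j \<in> int_adjoin y" for j
      unfolding c_def by (intro int_adjoin_sum B) (simp add: K_def)
    show "k1 mod ?Q < ?Q" "k2 mod ?Q < ?Q" using Q by (simp_all del: power_Suc)
    show "k1 mod ?Q mod q ^ e = k2 mod ?Q mod q ^ e"
      using k(4) by (simp add: mod_mod_cancel)
  qed
  moreover have "c (k mod ?Q) = B k" if k: "k < u" "k mod m = k1 mod m" for k
  proof -
    have "{k'. k' \<in> K \<and> k' mod ?Q = k mod ?Q} = {k}"
    proof (intro equalityI subsetI)
      fix k' assume "k' \<in> {k'. k' \<in> K \<and> k' mod ?Q = k mod ?Q}"
      then have k': "k' < u" "[k' = k] (mod m)" "[k' = k] (mod ?Q)"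
        using k(2) unfolding K_def cong_def by auto
      have "coprime ?Q m" using u(2) by (simp del: power_Suc)
      then have "[k' = k] (mod u)" unfolding u(1) using k'(2,3) by (intro coprime_cong_mult_nat)
      then show "k' \<in> {k}" using k(1) k'(1) unfolding cong_def by simp
    qed (use k in \<open>auto simp: K_def\<close>)
    then show ?thesis unfolding c_def by simp
  qed
  ultimately show ?thesis using k by simp
qed

section \<open>Counting functions on the \<open>p\<close>-th roots of unity\<close>

text \<open>The special case of order \<open>p\<close>, where all indices are congruent modulo \<open>p ^ 0\<close>.\<close>
lemma prime_root_coefficients_dvd:
  assumes p: "prime p" and \<zeta>: "primitive_root_of_unity p \<zeta>" "\<zeta> \<in> int_adjoin z" and z: "z ^ v = 1" "v > 0"
    and d: "dvd_adj z (of_nat p ^ a) (\<Sum>j<p. of_int (d j) * \<zeta> ^ j)" and ij: "i < p" "j < p"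
  shows "int p ^ a dvd d i - d j"
proof -
  have "dvd_adj 1 (of_nat p ^ a) (of_int (d i) - of_int (d j))"
  proof (rule coefficient_differences_dvd [OF p _ _ _ z, where w = 1 and e = 0])
    show "dvd_adj z (of_nat p ^ a) (\<Sum>j<p ^ Suc 0. of_int (d j) * \<zeta> ^ j)" using d by simp
  qed (use \<zeta> ij in simp_all)
  then have "dvd_adj 1 (of_nat p ^ a) (of_int (d i - d j))" by simp
  then show ?thesis by (rule dvd_adj_of_int_imp_dvd [OF p, of 1 1, rotated 2]) simp_all
qed

text \<open>This is the irreducibility of the \<open>p\<close>-th cyclotomic polynomial: a difference divisible by all powers
  of \<open>p\<close> vanishes.\<close>
lemma prime_root_relation_constant:
  assumes p: "prime p" and \<zeta>: "primitive_root_of_unity p \<zeta>"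
    and d: "(\<Sum>j<p. of_int (d j) * \<zeta> ^ j) = 0" and ij: "i < p" "j < p"
  shows "d i = d j"
proof (rule ccontr)
  assume "d i \<noteq> d j"
  define a where "a = nat \<bar>d i - d j\<bar>"
  have "\<zeta> ^ p = 1" "p > 0" using \<zeta> unfolding primitive_root_of_unity_def by auto
  then have "int p ^ a dvd d i - d j"
    by (intro prime_root_coefficients_dvd [OF p \<zeta> _ _ _ _ ij, of \<zeta> p]) (simp_all add: d)
  then have "int p ^ a \<le> \<bar>d i - d j\<bar>" using \<open>d i \<noteq> d j\<close> by (intro zdvd_imp_le) auto
  moreover have "int a < int (p ^ a)"
    using prime_gt_1_nat [OF p] by (simp only: of_nat_less_iff power_gt_expt)
  ultimately show False by (simp add: a_def)
qed

text \<open>Writing the quotient of the sum by \<open>q ^ a\<close> in powers of \<open>\<zeta>\<close> shows that the differences \<open>f j\<close> are all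
  congruent modulo \<open>q ^ a\<close>. Because they sum to \<open>0\<close> and \<open>p\<close> is invertible modulo \<open>q\<close>, they are congruent
  to \<open>0\<close>; and a nonzero one is at most \<open>m\<close> in absolute value.\<close>
lemma count_bound_other_prime:
  assumes p: "prime p" and q: "prime q" "q \<noteq> p" and \<zeta>: "primitive_root_of_unity p \<zeta>"
    and b: "(\<Sum>j<p. b j) = m" "(\<Sum>j<p. b' j) = (m :: nat)"
    and d: "dvd_adj \<zeta> (of_nat q ^ a) (\<Sum>j<p. of_int (int (b j) - int (b' j)) * \<zeta> ^ j)"
    and nz: "(\<Sum>j<p. of_int (int (b j) - int (b' j)) * \<zeta> ^ j) \<noteq> 0"
  shows "q ^ a \<le> m"
proof -
  define f where "f j = int (b j) - int (b' j)" for j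
  have \<zeta>1: "\<zeta> ^ p = 1" "p > 0" using \<zeta> unfolding primitive_root_of_unity_def by auto
  obtain x where x: "x \<in> int_adjoin \<zeta>" "(\<Sum>j<p. of_int (f j) * \<zeta> ^ j) = of_nat q ^ a * x"
    using d unfolding f_def by (rule dvd_adjE)
  obtain c where c: "x = (\<Sum>j<p. of_int (c j) * \<zeta> ^ j)"
    using int_adjoin_root_of_unity_sum [OF \<zeta>1 x(1)] by blast
  have "(\<Sum>j<p. of_int (f j - int q ^ a * c j) * \<zeta> ^ j) = 0"
    using x(2) by (simp add: c left_diff_distrib sum_subtractf sum_distrib_left mult.assoc)
  then have const: "f j - int q ^ a * c j = f 0 - int q ^ a * c 0" if "j < p" for j
    using prime_root_relation_constant [OF p \<zeta>, of "\<lambda>j. f j - int q ^ a * c j" j 0] that \<zeta>1 by blast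
  define C where "C = f 0 - int q ^ a * c 0"
  have fC: "f j = int q ^ a * c j + C" if "j < p" for j using const [OF that] by (simp add: C_def)
  have "(\<Sum>j<p. f j) = int (\<Sum>j<p. b j) - int (\<Sum>j<p. b' j)" by (simp add: f_def sum_subtractf)
  then have "0 = (\<Sum>j<p. f j)" using b by simp
  also have "\<dots> = (\<Sum>j<p. int q ^ a * c j + C)" by (intro sum.cong) (simp_all add: fC)
  also have "\<dots> = int q ^ a * (\<Sum>j<p. c j) + int p * C"
    by (simp add: sum.distrib sum_distrib_left)
  finally have "int p * C = int q ^ a * (- (\<Sum>j<p. c j))" by simp
  then have "int q ^ a dvd int p * C" by (metis dvd_triv_left)
  moreover have "coprime (int q ^ a) (int p)" using primes_coprime [OF q(1) p q(2)] by simp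
  ultimately have "int q ^ a dvd C" using coprime_dvd_mult_right_iff by blast
  then have df: "int q ^ a dvd f j" if "j < p" for j using fC [OF that] by simp
  obtain j where j: "j < p" "f j \<noteq> 0"
  proof (rule ccontr)
    assume "\<not> thesis"
    with that have "\<And>j. j < p \<Longrightarrow> f j = 0" by blast
    then show False using nz unfolding f_def by simp
  qed
  have "int q ^ a \<le> \<bar>f j\<bar>" using df [OF j(1)] j(2) by (intro zdvd_imp_le) auto
  also have "b j \<le> m" "b' j \<le> m"
    using member_le_sum [of j "{..<p}" b] member_le_sum [of j "{..<p}" b'] j(1) b by simp_all
  then have "\<bar>f j\<bar> \<le> int m" unfolding f_def by linarith
  finally show ?thesis by (simp only: of_nat_power [symmetric] of_nat_le_iff)
qed

text \<open>The hypothesis says that the polynomial with coefficients \<open>f j\<close> for \<open>j \<in> T\<close> vanishes to order \<open>s\<close> at \<open>1\<close>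
  modulo \<open>p\<close>; the binomial sums are its divided derivatives there. Such a polynomial with at most \<open>s\<close>
  terms is zero modulo \<open>p\<close>, by induction on the number of terms: the operator \<open>x * d/dx - k\<close> removes the term of
  exponent \<open>k\<close> and lowers the order of vanishing by at most one.\<close>
lemma few_nonzero_coefficients:
  fixes f :: "nat \<Rightarrow> int"
  assumes "prime p" "finite T" "T \<subseteq> {..<p}" "card T \<le> s"
    and "\<And>i. i < s \<Longrightarrow> int p dvd (\<Sum>j\<in>T. of_nat (j choose i) * f j)"
  shows "\<forall>j\<in>T. int p dvd f j"
  using assms(2-5)
proof (induction T arbitrary: f s rule: finite_induct)
  case (insert k T)
  define f' where "f' j = (int j - int k) * f j" for j
  have s: "s > 0" using insert by (cases s) auto
  have "\<forall>j\<in>T. int p dvd f' j"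
  proof (rule insert.IH)
    show "T \<subseteq> {..<p}" using insert by simp
    show "card T \<le> s - 1" using insert by simp
    fix i assume i: "i < s - 1"
    have absorb: "int j * int (j choose i)
        = (int i + 1) * int (j choose Suc i) + int i * int (j choose i)" for j
    proof -
      have "Suc i * (j choose Suc i) + i * (j choose i) = j * (j choose i)"
      proof (cases "i \<le> j")
        case True
        have "Suc i * (j choose Suc i) = (j - i) * (j choose i)"
          by (simp only: binomial_absorb_comp binomial_absorption)
        then have "Suc i * (j choose Suc i) + i * (j choose i) = ((j - i) + i) * (j choose i)"
          by (simp only: add_mult_distrib)
        then show ?thesis using True by (simp only: le_add_diff_inverse2)
      qed (simp add: binomial_eq_0)
      then have "int (Suc i * (j choose Suc i) + i * (j choose i)) = int (j * (j choose i))" by simp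
      then show ?thesis by (simp add: algebra_simps)
    qed
    have "(\<Sum>j\<in>T. of_nat (j choose i) * f' j) = (\<Sum>j\<in>insert k T. of_nat (j choose i) * f' j)"
      using insert by (simp add: f'_def)
    also have "\<dots> = (\<Sum>j\<in>insert k T. (int i + 1) * (of_nat (j choose Suc i) * f j)
        + (int i - int k) * (of_nat (j choose i) * f j))"
    proof (rule sum.cong)
      fix j
      have "of_nat (j choose i) * f' j = (int j * int (j choose i)) * f j - int k * int (j choose i) * f j"
        by (simp add: f'_def algebra_simps)
      then show "of_nat (j choose i) * f' j = (int i + 1) * (of_nat (j choose Suc i) * f j)
          + (int i - int k) * (of_nat (j choose i) * f j)"
        unfolding absorb by (simp add: algebra_simps)
    qed simp
    also have "\<dots> = (int i + 1) * (\<Sum>j\<in>insert k T. of_nat (j choose Suc i) * f j)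
        + (int i - int k) * (\<Sum>j\<in>insert k T. of_nat (j choose i) * f j)"
      by (simp only: sum.distrib sum_distrib_left)
    also have "int p dvd \<dots>"
      using i by (intro dvd_add dvd_mult insert.prems(3)) auto
    finally show "int p dvd (\<Sum>j\<in>T. of_nat (j choose i) * f' j)" .
  qed
  have T: "int p dvd f j" if j: "j \<in> T" for j
  proof -
    have "int p dvd (int j - int k) * f j" using \<open>\<forall>j\<in>T. int p dvd f' j\<close> j by (simp add: f'_def)
    moreover have "\<not> int p dvd int j - int k"
    proof
      assume d: "int p dvd int j - int k"
      have "j \<noteq> k" using j insert.hyps by auto
      then have "int p \<le> \<bar>int j - int k\<bar>" using d by (intro zdvd_imp_le) auto
      moreover have "j < p" "k < p" using j insert.prems(1) by auto
      ultimately show False by linarith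
    qed
    ultimately show ?thesis using assms(1) by (metis prime_dvd_multD prime_nat_int_transfer)
  qed
  have "int p dvd f k + (\<Sum>j\<in>T. f j)" using insert.prems(3) [OF s] insert.hyps by simp
  moreover have "int p dvd (\<Sum>j\<in>T. f j)" by (rule dvd_sum) (rule T)
  ultimately have "int p dvd f k" by (simp add: dvd_add_left_iff)
  then show ?case using T by simp
qed simp

text \<open>If the value \<open>r\<close> is taken so often that at most \<open>s\<close> of the \<open>d j\<close> differ from it, subtracting \<open>r\<close> from all
  coefficients, which does not change the sum, leaves at most \<open>s\<close> of them. After division by \<open>p ^ a\<close>,
  \<open>few_nonzero_coefficients\<close> produces one more factor \<open>p\<close>.\<close>
lemma frequent_value_imp_congruent:
  assumes p: "prime p" and \<zeta>: "primitive_root_of_unity p \<zeta>" "\<zeta> \<in> int_adjoin z" and z: "z ^ v = 1" "v > 0"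
    and s: "s \<le> p - 1"
    and d: "dvd_adj z (of_nat p ^ a * (1 - \<zeta>) ^ s) (\<Sum>j<p. of_int (d j) * \<zeta> ^ j)"
    and many: "p - card {j. j < p \<and> d j = r} \<le> s" "{j. j < p \<and> d j = r} \<noteq> {}" and j: "j < p"
  shows "int p ^ (a + 1) dvd d j - r"
proof -
  have p1: "p > 1" using prime_gt_1_nat [OF p] .
  have \<zeta>1: "\<zeta> ^ p = 1" "\<zeta> \<noteq> 1" "\<zeta> ^ 1 \<noteq> 1"
    using \<zeta>(1) p1 primitive_root_power_eq_1_iff [OF \<zeta>(1), of 1] unfolding primitive_root_of_unity_def by auto
  obtain j0 where j0: "j0 < p" "d j0 = r" using many(2) by blast
  have pz: "of_nat p \<noteq> (0 :: complex)" using p1 by simp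
  have "dvd_adj z (of_nat p ^ a) (of_nat p ^ a * (1 - \<zeta>) ^ s)"
    by (rule dvd_adj_mult [OF dvd_adj_refl]) (intro int_adjoin_power int_adjoin_diff \<zeta>(2) int_adjoin_1)
  then have "dvd_adj z (of_nat p ^ a) (\<Sum>j<p. of_int (d j) * \<zeta> ^ j)" using d by (rule dvd_adj_trans)
  then have "int p ^ a dvd d j - d j0" if "j < p" for j
    by (rule prime_root_coefficients_dvd [OF p \<zeta> z _ that j0(1)])
  then have "\<forall>j. \<exists>x. j < p \<longrightarrow> d j - r = int p ^ a * x" using j0(2) by (auto elim: dvdE)
  then obtain g where g: "\<And>j. j < p \<Longrightarrow> d j - r = int p ^ a * g j" by metis
  have "(\<Sum>j<p. of_int (d j) * \<zeta> ^ j)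
      = (\<Sum>j<p. of_nat p ^ a * (of_int (g j) * \<zeta> ^ j) + of_int r * \<zeta> ^ j)"
  proof (rule sum.cong)
    fix j assume "j \<in> {..<p}"
    then have "d j = int p ^ a * g j + r" using g [of j] by simp
    then show "of_int (d j) * \<zeta> ^ j = of_nat p ^ a * (of_int (g j) * \<zeta> ^ j) + of_int r * \<zeta> ^ j"
      by (simp add: algebra_simps)
  qed simp
  also have "\<dots> = of_nat p ^ a * (\<Sum>j<p. of_int (g j) * \<zeta> ^ j)"
    using root_of_unity_sum_eq_0 [OF \<zeta>1(1,2)]
    by (simp add: sum.distrib sum_distrib_left [symmetric])
  finally have e: "(\<Sum>j<p. of_int (d j) * \<zeta> ^ j) = of_nat p ^ a * (\<Sum>j<p. of_int (g j) * \<zeta> ^ j)" .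
  have "of_nat p ^ a \<noteq> (0 :: complex)" using pz by simp
  then have dg: "dvd_adj z ((1 - \<zeta>) ^ s) (\<Sum>j<p. of_int (g j) * \<zeta> ^ j)"
    using d unfolding e by (rule iffD1 [OF dvd_adj_cancel])
  define T where "T = {j. j < p \<and> d j \<noteq> r}"
  have g0: "g j = 0" if "j < p" "j \<notin> T" for j
    using g [OF that(1)] that p1 by (simp add: T_def)
  have "T = {..<p} - {j. j < p \<and> d j = r}" unfolding T_def by auto
  then have "card T \<le> s" using many(1) by (simp add: card_Diff_subset subset_eq)
  moreover have "int p dvd (\<Sum>j\<in>T. of_nat (j choose i) * g j)" if i: "i < s" for i
  proof -
    have "dvd_adj 1 (of_nat p) (\<Sum>j<p. of_nat (j choose i) * of_int (g j))"
    proof (rule binomial_sums_dvd [OF p _ _ _ z, where w = 1 and e = 0])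
      show "s \<le> p ^ 0 * (p - 1)" using s by simp
    qed (use \<zeta> dg i in simp_all)
    then have "dvd_adj 1 (of_nat p ^ 1) (of_int (\<Sum>j<p. of_nat (j choose i) * g j))" by simp
    then have "int p ^ 1 dvd (\<Sum>j<p. of_nat (j choose i) * g j)"
      by (rule dvd_adj_of_int_imp_dvd [OF p, of 1 1, rotated 2]) simp_all
    also have "(\<Sum>j<p. of_nat (j choose i) * g j) = (\<Sum>j\<in>T. of_nat (j choose i) * g j)"
      by (rule sum.mono_neutral_right) (auto simp: T_def g0)
    finally show ?thesis by simp
  qed
  ultimately have "\<forall>j\<in>T. int p dvd g j"
    by (intro few_nonzero_coefficients [OF p, where s = s]) (auto simp: T_def)
  then have "int p dvd g j" using g0 [OF j] by (cases "j \<in> T") auto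
  then show ?thesis using g [OF j] by (simp add: mult.commute)
qed

text \<open>Integers in one residue class modulo \<open>h\<close> other than the two closest to \<open>0\<close>, which are \<open>v\<close> and \<open>v - h\<close>, have
  absolute value at least \<open>h\<close>. The pointwise bound below interpolates between these cases linearly in \<open>v\<close>,
  so that it suffices to count how often \<open>v\<close> and \<open>v - h\<close> are avoided.\<close>
lemma sum_abs_of_spread_values:
  fixes d :: "nat \<Rightarrow> int"
  assumes h: "h > 0" and d: "\<And>j. j < p \<Longrightarrow> h dvd d j - d 0"
    and few: "\<And>r. c \<le> card {j. j < p \<and> d j \<noteq> r}"
  shows "h * int c \<le> (\<Sum>j<p. \<bar>d j\<bar>)"
proof -
  define v where "v = d 0 mod h"
  have v: "0 \<le> v" "v < h" using h by (simp_all add: v_def)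
  have pt: "\<bar>d j\<bar> \<ge> v * (if d j \<noteq> v - h then 1 else 0) + (h - v) * (if d j \<noteq> v then 1 else 0)"
    if j: "j < p" for j
  proof -
    have "h dvd (d j - d 0) + (d 0 - v)" using d [OF j] by (intro dvd_add) (simp_all add: v_def)
    then obtain x where "d j - v = h * x" by (auto elim: dvdE)
    then have x: "d j = v + h * x" by simp
    have le: "v * (if P then 1 else 0) + (h - v) * (if Q then 1 else 0) \<le> h" for P Q
      using v by auto
    consider "x = 0" | "x = -1" | "x \<ge> 1" | "x \<le> -2" by linarith
    then show ?thesis
    proof cases
      case 3
      then have "h * 1 \<le> h * x" using h by (intro mult_left_mono) simp_all
      then have "h \<le> \<bar>d j\<bar>" using v h unfolding x by linarith
      then show ?thesis using le by (meson order_trans)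
    next
      case 4
      then have "h * x \<le> h * (-2)" using h by (intro mult_left_mono) simp_all
      then have "h \<le> \<bar>d j\<bar>" using v h unfolding x by linarith
      then show ?thesis using le by (meson order_trans)
    qed (use v h x in auto)
  qed
  have card: "(\<Sum>j<p. if d j \<noteq> r then 1 else 0) = int (card {j. j < p \<and> d j \<noteq> r})" for r
    by (simp add: sum.If_cases Int_def)
  have "h * int c = v * int c + (h - v) * int c" by (simp add: algebra_simps)
  also have "\<dots> \<le> v * int (card {j. j < p \<and> d j \<noteq> v - h}) + (h - v) * int (card {j. j < p \<and> d j \<noteq> v})"
    using v few by (intro add_mono mult_left_mono) auto
  also have "\<dots> = (\<Sum>j<p. v * (if d j \<noteq> v - h then 1 else 0) + (h - v) * (if d j \<noteq> v then 1 else 0))"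
    unfolding card [symmetric] by (simp only: sum.distrib sum_distrib_left)
  also have "\<dots> \<le> (\<Sum>j<p. \<bar>d j\<bar>)" by (intro sum_mono pt) simp
  finally show ?thesis .
qed

text \<open>The differences sum to \<open>0\<close>, so if they were all equal they would vanish.\<close>
lemma counts_differ:
  fixes b b' :: "nat \<Rightarrow> nat" and \<zeta> :: complex
  assumes "(\<Sum>j<p. b j) = m" "(\<Sum>j<p. b' j) = m" "p > 0"
    and "(\<Sum>j<p. of_int (int (b j) - int (b' j)) * \<zeta> ^ j) \<noteq> 0"
  obtains i j where "i < p" "j < p" "int (b i) - int (b' i) \<noteq> int (b j) - int (b' j)"
proof (rule ccontr)
  assume "\<not> thesis"
  with that have eq: "\<And>j. j < p \<Longrightarrow> int (b j) - int (b' j) = int (b 0) - int (b' 0)"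
    using assms(3) by blast
  have "(\<Sum>j<p. int (b j) - int (b' j)) = int (\<Sum>j<p. b j) - int (\<Sum>j<p. b' j)"
    by (simp add: sum_subtractf)
  then have "(\<Sum>j<p. int (b j) - int (b' j)) = 0" using assms by simp
  moreover have "(\<Sum>j<p. int (b j) - int (b' j)) = (\<Sum>j<p. int (b 0) - int (b' 0))"
    by (rule sum.cong [OF refl eq]) simp
  ultimately have b0: "int (b 0) - int (b' 0) = 0" using assms(3) by simp
  have "(\<Sum>j<p. of_int (int (b j) - int (b' j)) * \<zeta> ^ j) = 0"
  proof (intro sum.neutral ballI)
    fix j assume "j \<in> {..<p}"
    then have "int (b j) - int (b' j) = 0" using eq [of j] b0 by (metis lessThan_iff)
    then show "of_int (int (b j) - int (b' j)) * \<zeta> ^ j = 0" by (simp only: of_int_0 mult_zero_left)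
  qed
  then show False using assms(4) by simp
qed

lemma count_difference_bound:
  fixes b b' :: "nat \<Rightarrow> nat"
  assumes "(\<Sum>j<p. b j) = m" "(\<Sum>j<p. b' j) = m" "i < p" "j < p"
    and "int h dvd (int (b i) - int (b' i)) - (int (b j) - int (b' j))"
    and "int (b i) - int (b' i) \<noteq> int (b j) - int (b' j)"
  shows "h \<le> 2 * m"
proof -
  have "int h \<le> \<bar>(int (b i) - int (b' i)) - (int (b j) - int (b' j))\<bar>"
    using assms(5,6) by (intro zdvd_imp_le) auto
  moreover have "b k \<le> m" "b' k \<le> m" if "k < p" for k
    using member_le_sum [of k "{..<p}" b] member_le_sum [of k "{..<p}" b'] that assms(1,2) by simp_all
  then have "b i \<le> m" "b' i \<le> m" "b j \<le> m" "b' j \<le> m" using assms(3,4) by auto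
  ultimately show ?thesis by linarith
qed

lemma count_bound_same_prime_even:
  assumes p: "prime p" and \<zeta>: "primitive_root_of_unity p \<zeta>" "\<zeta> \<in> int_adjoin z" and z: "z ^ v = 1" "v > 0"
    and b: "(\<Sum>j<p. b j) = m" "(\<Sum>j<p. b' j) = (m :: nat)"
    and d: "dvd_adj z (of_nat p ^ a) (\<Sum>j<p. of_int (int (b j) - int (b' j)) * \<zeta> ^ j)"
    and nz: "(\<Sum>j<p. of_int (int (b j) - int (b' j)) * \<zeta> ^ j) \<noteq> 0"
  shows "p ^ a \<le> 2 * m"
proof -
  obtain i j where ij: "i < p" "j < p" "int (b i) - int (b' i) \<noteq> int (b j) - int (b' j)"
    using counts_differ [OF b prime_gt_0_nat [OF p] nz] .
  have "int p ^ a dvd (int (b i) - int (b' i)) - (int (b j) - int (b' j))"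
    by (rule prime_root_coefficients_dvd [OF p \<zeta> z d ij(1,2)])
  then have "int (p ^ a) dvd (int (b i) - int (b' i)) - (int (b j) - int (b' j))" by simp
  then show ?thesis by (rule count_difference_bound [OF b ij(1,2) _ ij(3)])
qed

text \<open>Either some value is taken by more than half of the differences; then they are all congruent modulo
  \<open>p ^ (a + 1)\<close> and two different ones give the bound. Or every value is avoided at least
  \<open>(p + 1) div 2\<close> times; then the absolute values sum to at least \<open>p ^ a * ((p + 1) div 2)\<close>, while this
  sum is at most \<open>2 * m\<close>.\<close>
lemma count_bound_same_prime_odd:
  assumes p: "prime p" "odd p" and \<zeta>: "primitive_root_of_unity p \<zeta>" "\<zeta> \<in> int_adjoin z" and z: "z ^ v = 1" "v > 0"
    and b: "(\<Sum>j<p. b j) = m" "(\<Sum>j<p. b' j) = (m :: nat)"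
    and d: "dvd_adj z (of_nat p ^ a * (1 - \<zeta>) ^ ((p - 1) div 2)) (\<Sum>j<p. of_int (int (b j) - int (b' j)) * \<zeta> ^ j)"
    and nz: "(\<Sum>j<p. of_int (int (b j) - int (b' j)) * \<zeta> ^ j) \<noteq> 0"
  shows "p ^ (a + 1) \<le> 4 * m"
proof -
  define f where "f j = int (b j) - int (b' j)" for j
  have p0: "p > 0" using prime_gt_0_nat [OF p(1)] .
  show ?thesis
  proof (cases "\<exists>r. {j. j < p \<and> f j = r} \<noteq> {} \<and> p - card {j. j < p \<and> f j = r} \<le> (p - 1) div 2")
    case True
    then obtain r where r: "{j. j < p \<and> f j = r} \<noteq> {}" "p - card {j. j < p \<and> f j = r} \<le> (p - 1) div 2" by blast
    obtain i j where ij: "i < p" "j < p" "int (b i) - int (b' i) \<noteq> int (b j) - int (b' j)"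
      using counts_differ [OF b p0 nz] .
    have pd: "int p ^ (a + 1) dvd f j - r" if "j < p" for j
      by (rule frequent_value_imp_congruent [OF p(1) \<zeta> z _ _ r(2,1) that]) (use d in \<open>simp_all add: f_def\<close>)
    have "int p ^ (a + 1) dvd (f i - r) - (f j - r)"
      by (rule dvd_diff [OF pd [OF ij(1)] pd [OF ij(2)]])
    moreover have "(f i - r) - (f j - r) = f i - f j" by simp
    ultimately have "int (p ^ (a + 1)) dvd (int (b i) - int (b' i)) - (int (b j) - int (b' j))"
      by (simp only: f_def of_nat_power)
    then have "p ^ (a + 1) \<le> 2 * m" by (rule count_difference_bound [OF b ij(1,2) _ ij(3)])
    then show ?thesis by simp
  next
    case False
    have "dvd_adj z (of_nat p ^ a) (of_nat p ^ a * (1 - \<zeta>) ^ ((p - 1) div 2))"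
      by (rule dvd_adj_mult [OF dvd_adj_refl]) (intro int_adjoin_power int_adjoin_diff \<zeta>(2) int_adjoin_1)
    then have da: "dvd_adj z (of_nat p ^ a) (\<Sum>j<p. of_int (f j) * \<zeta> ^ j)"
      using d unfolding f_def by (rule dvd_adj_trans)
    have "int p ^ a * int ((p + 1) div 2) \<le> (\<Sum>j<p. \<bar>f j\<bar>)"
    proof (rule sum_abs_of_spread_values)
      show "int p ^ a > 0" using p0 by simp
      show "int p ^ a dvd f j - f 0" if "j < p" for j
        by (rule prime_root_coefficients_dvd [OF p(1) \<zeta> z da that p0])
      fix r
      have "{j. j < p \<and> f j \<noteq> r} = {..<p} - {j. j < p \<and> f j = r}" by auto
      then have "card {j. j < p \<and> f j \<noteq> r} = p - card {j. j < p \<and> f j = r}"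
        by (simp add: card_Diff_subset subset_eq)
      moreover have "(p + 1) div 2 \<le> p - card {j. j < p \<and> f j = r}"
      proof (cases "{j. j < p \<and> f j = r} = {}")
        case True
        then show ?thesis using p0 unfolding True by simp
      next
        case nonempty: False
        then have "(p - 1) div 2 < p - card {j. j < p \<and> f j = r}" using False by (metis not_le)
        moreover have "2 * ((p - 1) div 2) = p - 1" using p(2) by simp
        ultimately show ?thesis by linarith
      qed
      ultimately show "(p + 1) div 2 \<le> card {j. j < p \<and> f j \<noteq> r}" by simp
    qed
    also have "\<dots> \<le> (\<Sum>j<p. int (b j) + int (b' j))" by (rule sum_mono) (simp add: f_def)
    also have "\<dots> = int (\<Sum>j<p. b j) + int (\<Sum>j<p. b' j)" by (simp add: sum.distrib)
    also have "\<dots> = int (2 * m)" using b by simp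
    finally have "int (p ^ a * ((p + 1) div 2)) \<le> int (2 * m)" by simp
    then have "p ^ a * ((p + 1) div 2) \<le> 2 * m" by (simp only: of_nat_le_iff)
    then have "2 * (p ^ a * ((p + 1) div 2)) \<le> 4 * m" by linarith
    moreover have "p ^ a * p \<le> p ^ a * (2 * ((p + 1) div 2))" by (rule mult_le_mono2) simp
    moreover have "p ^ a * (2 * ((p + 1) div 2)) = 2 * (p ^ a * ((p + 1) div 2))" by (rule mult.left_commute)
    moreover have "p ^ (a + 1) = p ^ a * p" by simp
    ultimately show ?thesis by linarith
  qed
qed

section \<open>Class sums of nearly perfect sequences\<close>

lemma card_residue_class:
  assumes "u > 0"
  shows "card {i. i < u * m \<and> i mod u = k mod u} = m"
proof -
  have "{i. i < u * m \<and> i mod u = k mod u} = (\<lambda>l. k mod u + u * l) ` {..<m}"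
  proof (intro equalityI subsetI)
    fix i assume i: "i \<in> {i. i < u * m \<and> i mod u = k mod u}"
    have r: "i mod u = k mod u" using i by simp
    have "i = k mod u + u * (i div u)" unfolding r [symmetric] by simp
    moreover have "i div u < m" using i by (simp add: less_mult_imp_div_less mult.commute)
    ultimately show "i \<in> (\<lambda>l. k mod u + u * l) ` {..<m}" by blast
  next
    fix i assume "i \<in> (\<lambda>l. k mod u + u * l) ` {..<m}"
    then obtain l where l: "l < m" "i = k mod u + u * l" by auto
    have "u * Suc l \<le> u * m" using l(1) by (intro mult_le_mono2) simp
    moreover have "k mod u < u" using assms by simp
    ultimately have "i < u * m" unfolding l(2) by simp
    then show "i \<in> {i. i < u * m \<and> i mod u = k mod u}" by (simp add: l(2))
  qed
  moreover have "inj_on (\<lambda>l. k mod u + u * l) {..<m}" using assms by (auto simp: inj_on_def)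
  ultimately show ?thesis by (simp add: card_image)
qed

text \<open>\<open>b k j\<close> counts the indices in the class of \<open>k\<close> whose entry is \<open>\<zeta> ^ j\<close>.\<close>
lemma class_sum_counts:
  assumes \<zeta>: "primitive_root_of_unity p \<zeta>" and a: "\<And>i. a i ^ p = 1" and u: "u > 0" "u dvd n"
  shows "\<exists>b :: nat \<Rightarrow> nat \<Rightarrow> nat. \<forall>k. class_sum a n u k = (\<Sum>j<p. of_nat (b k j) * \<zeta> ^ j)
    \<and> (\<Sum>j<p. b k j) = n div u"
proof -
  have "\<forall>i. \<exists>j. j < p \<and> a i = \<zeta> ^ j" using root_of_unity_eq_power [OF \<zeta> a] by metis
  then obtain J where J: "\<And>i. J i < p" "\<And>i. a i = \<zeta> ^ J i" by metis
  define I where "I k = {i. i < n \<and> i mod u = k mod u}" for k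
  define b where "b k j = card {i. i \<in> I k \<and> J i = j}" for k j
  have fin: "finite (I k)" for k unfolding I_def by simp
  have "class_sum a n u k = (\<Sum>j<p. of_nat (b k j) * \<zeta> ^ j)" for k
  proof -
    have "class_sum a n u k = (\<Sum>j<p. \<Sum>i | i \<in> I k \<and> J i = j. \<zeta> ^ J i)"
      unfolding class_sum_def J(2) I_def [symmetric] by (rule sum.group [symmetric]) (use J(1) fin in auto)
    also have "\<dots> = (\<Sum>j<p. of_nat (b k j) * \<zeta> ^ j)" by (intro sum.cong) (simp_all add: b_def)
    finally show ?thesis .
  qed
  moreover have "(\<Sum>j<p. b k j) = n div u" for k
  proof -
    have "(\<Sum>j<p. b k j) = (\<Sum>j<p. \<Sum>i | i \<in> I k \<and> J i = j. 1)" by (simp add: b_def)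
    also have "\<dots> = (\<Sum>i\<in>I k. 1)" by (rule sum.group) (use J(1) fin in auto)
    also have "\<dots> = card (I k)" by simp
    also have "\<dots> = n div u" using card_residue_class [OF u(1), of "n div u" k] u(2) by (simp add: I_def)
    finally show ?thesis .
  qed
  ultimately show ?thesis by (intro exI [of _ b]) simp
qed

text \<open>The shift is \<open>1\<close> if \<open>q\<close> does not divide \<open>u\<close>, and \<open>u / q\<close> otherwise: in the second case only characters
  of order divisible by the full power of \<open>q\<close> in \<open>u\<close> are used, and they control \<open>B\<close> up to functions that
  are invariant under translation by \<open>u / q\<close>.\<close>
lemma shift_differences_dvd:
  assumes p: "prime p" and q: "prime q" "q \<noteq> p" and z: "primitive_root_of_unity (u * p) z" and u: "u > 1"
    and B: "\<And>k. B k \<in> int_adjoin (z ^ u)" and per: "\<And>k. B (k mod u) = B k"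
    and X: "\<And>x. x ^ u = 1 \<Longrightarrow> x \<noteq> 1 \<Longrightarrow> dvd_adj z (of_nat q ^ a) (\<Sum>k<u. B k * x ^ k)"
  obtains s where "\<not> u dvd s" "\<And>k. dvd_adj (z ^ u) (of_nat q ^ a) (B k - B (k + s))"
proof -
  have p0: "p > 0" using prime_gt_0_nat [OF p] .
  have z1: "z ^ (u * p) = 1" "u * p > 0" using z unfolding primitive_root_of_unity_def by auto
  have y: "(z ^ u) ^ p = 1" using z1(1) by (simp add: power_mult)
  have yz: "z ^ u \<in> int_adjoin z" by (intro int_adjoin_power int_adjoin_generator)
  have qp: "coprime q p" using primes_coprime [OF q(1) p q(2)] .
  show ?thesis
  proof (cases "q dvd u")
    case False
    have \<theta>: "primitive_root_of_unity u (z ^ p)"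
      using primitive_root_power [of p u z] z p0 by (simp add: mult.commute)
    have cop: "coprime u q" using prime_imp_coprime [OF q(1) False] by (simp add: coprime_commute)
    have "dvd_adj (z ^ u) (of_nat q ^ a) (B k - B (k + 1))" for k
    proof (rule saturation_power [OF q(1) qp y p0 z1 int_adjoin_diff [OF B B]])
      have "dvd_adj z (of_nat q ^ a) (B (k mod u) - B ((k + 1) mod u))"
      proof (rule class_differences_dvd_coprime [OF z1 \<theta> _ _ cop dvd_adj_refl X])
        show "B k \<in> int_adjoin z" for k using B int_adjoin_subset [OF yz] by blast
      qed (use u in \<open>auto intro: int_adjoin_power\<close>)
      then show "dvd_adj z (of_nat q ^ a) (B k - B (k + 1))" by (simp only: per)
    qed
    moreover have "\<not> u dvd 1" using u by simp
    ultimately show ?thesis by (rule that [rotated])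
  next
    case True
    have "multiplicity q u > 0" using True q(1) u by (simp add: prime_multiplicity_gt_zero_iff)
    then obtain e where e: "multiplicity q u = Suc e" by (cases "multiplicity q u") auto
    obtain m where m: "u = q ^ Suc e * m" "\<not> q dvd m"
      using multiplicity_decompose' [of u q] u q(1) e by (metis not_prime_unit not_less_zero)
    have m0: "m > 0" and q0: "q > 0" using m u prime_gt_0_nat [OF q(1)] by (auto intro: gr0I)
    have cop: "coprime q m" using prime_imp_coprime [OF q(1) m(2)] .
    have \<alpha>: "primitive_root_of_unity (q ^ Suc e) (z ^ (m * p))"
      using primitive_root_power [of "m * p" "q ^ Suc e" z] z m0 p0 by (simp add: m mult_ac)
    have \<beta>: "primitive_root_of_unity m (z ^ (q ^ Suc e * p))"
      using primitive_root_power [of "q ^ Suc e * p" m z] z q0 p0 by (simp add: m mult_ac)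
    have \<beta>1: "(z ^ (q ^ Suc e * p)) ^ m = 1" using \<beta> unfolding primitive_root_of_unity_def by simp
    let ?s = "q ^ e * m"
    have "?s < u" unfolding m(1) using prime_gt_1_nat [OF q(1)] m0 by simp
    moreover have "?s > 0" using m0 q0 by simp
    ultimately have "\<not> u dvd ?s" by (auto dest: dvd_imp_le)
    moreover have "dvd_adj (z ^ u) (of_nat q ^ a) (B k - B (k + ?s))" for k
    proof -
      have "dvd_adj (z ^ u) (of_nat q ^ a) (B (k mod u) - B ((k + ?s) mod u))"
      proof (rule class_differences_dvd_ramified [OF q(1) qp y p0 z1 \<alpha> _ yz \<beta> _ m(1) cop B])
        fix l
        let ?x = "z ^ (m * p) * (z ^ (q ^ Suc e * p)) ^ l"
        have pow: "?x ^ i = (z ^ (m * p)) ^ i * ((z ^ (q ^ Suc e * p)) ^ i) ^ l" for i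
          unfolding power_mult_distrib by (simp only: power_mult [symmetric] mult.assoc mult.commute [of l i])
        show "dvd_adj z (of_nat q ^ a) (\<Sum>k<u. B k * ?x ^ k)"
        proof (rule X)
          have "(z ^ (m * p)) ^ u = 1"
            unfolding primitive_root_power_eq_1_iff [OF \<alpha>] m(1) by (rule dvd_triv_left)
          moreover have "(z ^ (q ^ Suc e * p)) ^ u = 1"
            unfolding primitive_root_power_eq_1_iff [OF \<beta>] m(1) by (rule dvd_triv_right)
          ultimately show "?x ^ u = 1" by (simp only: pow power_one mult_1)
          show "?x \<noteq> 1"
          proof
            assume "?x = 1"
            then have "?x ^ m = 1" by (simp only: power_one)
            then have "(z ^ (m * p)) ^ m * ((z ^ (q ^ Suc e * p)) ^ m) ^ l = 1" unfolding pow .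
            then have "(z ^ (m * p)) ^ m = 1" unfolding \<beta>1 by simp
            then have "q ^ Suc e dvd m" unfolding primitive_root_power_eq_1_iff [OF \<alpha>] .
            then show False using m(2) by (metis dvd_mult_left power_Suc)
          qed
        qed
      next
        show "(k mod u) mod m = ((k + ?s) mod u) mod m"
          unfolding m(1) by (simp add: mod_mod_cancel)
        have "q ^ e dvd u" unfolding m(1) by simp
        then show "(k mod u) mod q ^ e = ((k + ?s) mod u) mod q ^ e"
          by (simp add: mod_mod_cancel)
      qed (use u in \<open>auto intro: int_adjoin_power\<close>)
      then show ?thesis by (simp only: per)
    qed
    ultimately show ?thesis by (rule that)
  qed
qed

text \<open>A function invariant under translation by \<open>s\<close> has character sum \<open>0\<close> at every \<open>\<theta>\<close> with \<open>\<theta> ^ s \<noteq> 1\<close>.\<close>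
lemma exists_shift_difference:
  assumes "(\<theta> :: complex) ^ u = 1" "\<theta> ^ s \<noteq> 1" "\<And>k. B (k mod u) = B k" "(\<Sum>k<u. B k * \<theta> ^ k) \<noteq> 0"
  obtains k where "B k \<noteq> B (k + s)"
proof (rule ccontr)
  assume "\<not> thesis"
  with that have "\<And>k. B (k + s) = B k" by metis
  then have "(\<Sum>k<u. B k * \<theta> ^ k) = 0"
    using assms(1-3) by (intro periodic_coefficients_sum_eq_0 [where t = s]) (metis mod_add_self2)+
  then show False using assms(4) by simp
qed

lemma class_sum_mod: "class_sum a n u (k mod u) = class_sum a n u k"
  unfolding class_sum_def by simp

lemma root_in_int_adjoin:
  assumes "primitive_root_of_unity (u * p) z" "u > 0" "p > 0" "x ^ p = 1"
  shows "x \<in> int_adjoin (z ^ u)"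
proof -
  have "primitive_root_of_unity p (z ^ u)" using primitive_root_power [of u p z] assms by simp
  then obtain j where "x = (z ^ u) ^ j" using root_of_unity_eq_power assms(4) by blast
  then show ?thesis by auto
qed

lemma class_sum_mem:
  assumes "primitive_root_of_unity (u * p) z" "u > 0" "p > 0" "\<And>i. a i ^ p = 1"
  shows "class_sum a n u k \<in> int_adjoin (z ^ u)"
  unfolding class_sum_def by (intro int_adjoin_sum root_in_int_adjoin [OF assms(1-4)])

lemma character_sum_mem:
  assumes "primitive_root_of_unity (u * p) z" "u > 0" "p > 0" "\<And>i. a i ^ p = 1" "x ^ u = 1"
  shows "(\<Sum>i<n. a i * x ^ i) \<in> int_adjoin z"
proof (intro int_adjoin_sum int_adjoin_mult int_adjoin_power)
  have "x \<in> int_adjoin (z ^ p)"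
    using root_in_int_adjoin [of p u z x] assms by (simp add: mult.commute)
  then show "x \<in> int_adjoin z" using int_adjoin_subset [of "z ^ p" z] by auto
  show "a i \<in> int_adjoin z" for i
    using root_in_int_adjoin [OF assms(1-4)] int_adjoin_subset [of "z ^ u" z] by auto
qed

lemma nontrivial_character_norm:
  assumes "nearly_perfect_sequence p n \<gamma> a" "p > 0" "n > 0" "u dvd n" "x ^ u = 1" "x \<noteq> 1"
  shows "(\<Sum>i<n. a i * x ^ i) * cnj (\<Sum>i<n. a i * x ^ i) = of_int (int n - \<gamma>)"
proof -
  have "x ^ n = 1" using assms(4,5) by (elim dvdE) (simp add: power_mult)
  then show ?thesis using character_norm [OF assms(1-3), of x] assms(6) by simp
qed

lemma nontrivial_character_neq_0:
  assumes "nearly_perfect_sequence p n \<gamma> a" "p > 0" "n > 0" "u > 0" "u dvd n" "x ^ u = 1" "x \<noteq> 1"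
    and "int n - \<gamma> \<noteq> 0"
  shows "(\<Sum>k<u. class_sum a n u k * x ^ k) \<noteq> 0"
  unfolding character_via_class_sums [OF assms(4,6), symmetric]
proof
  assume "(\<Sum>i<n. a i * x ^ i) = 0"
  with nontrivial_character_norm [OF assms(1-3,5-7)] have "of_int (int n - \<gamma>) = (0 :: complex)"
    by (simp only: mult_zero_left)
  then show False using assms(8) by (simp only: of_int_eq_0_iff)
qed

lemma self_conjugate_modE:
  assumes "prime q" "v > 0" "self_conjugate_mod q v"
  obtains e w j where "v = q ^ e * w" "coprime q w" "j \<ge> 1" "w dvd q ^ j + 1"
proof -
  obtain e w j where *: "v = q ^ e * w" "coprime q w" "[int q ^ j = -1] (mod int w)"
    using assms(3) unfolding self_conjugate_mod_def by blast
  have "w > 0" using *(1) assms(2) by (cases w) auto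
  then obtain k where "k \<ge> 1" "w dvd q ^ k + 1" using self_conjugate_exponent [OF *(2) _ *(3)] by blast
  then show ?thesis using that * by blast
qed

lemma class_sum_difference:
  assumes "\<And>k. class_sum a n u k = (\<Sum>j<p. of_nat (b k j) * \<zeta> ^ j)"
  shows "class_sum a n u k - class_sum a n u l = (\<Sum>j<p. of_int (int (b k j) - int (b l j)) * \<zeta> ^ j)"
  unfolding assms by (simp add: sum_subtractf left_diff_distrib)

text \<open>A nontrivial character sum does not vanish, so some class sum changes under the shift supplied by
  \<open>shift_differences_dvd\<close>; the counts of these two classes differ, but agree modulo \<open>q ^ (r div 2)\<close>.\<close>
lemma other_prime_bound:
  assumes a: "nearly_perfect_sequence p n \<gamma> a" and p: "prime p" and n: "n > 0" "int n - \<gamma> \<noteq> 0"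
    and q: "prime q" "q \<noteq> p" "int q ^ r dvd int n - \<gamma>" and u: "u > 1" "u dvd n"
    and sc: "self_conjugate_mod q (u * p)"
  shows "q ^ (r div 2) \<le> n div u"
proof -
  have p0: "p > 0" using prime_gt_0_nat [OF p] .
  have seq: "a i ^ p = 1" for i
    using a unfolding nearly_perfect_sequence_def by (intro p_ary_entry_power [of p n]) simp
  obtain e w j where w: "u * p = q ^ e * w" "coprime q w" "j \<ge> 1" "w dvd q ^ j + 1"
    using self_conjugate_modE [OF q(1) _ sc] u p0 by auto
  obtain z where z: "primitive_root_of_unity (u * p) z"
    using primitive_root_of_unity_exists [of "u * p"] u p0 by auto
  have u0: "u > 0" using u by simp
  have \<zeta>: "primitive_root_of_unity p (z ^ u)" using primitive_root_power [OF z u0] .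
  have \<theta>: "primitive_root_of_unity u (z ^ p)"
    using primitive_root_power [of p u z] z p0 by (simp add: mult.commute)
  have \<theta>u: "(z ^ p) ^ u = 1" using \<theta> unfolding primitive_root_of_unity_def by simp
  have \<theta>1: "z ^ p \<noteq> 1" using primitive_root_power_eq_1_iff [OF \<theta>, of 1] u by auto
  let ?B = "class_sum a n u"
  have X: "dvd_adj z (of_nat q ^ (r div 2)) (\<Sum>k<u. ?B k * x ^ k)" if x: "x ^ u = 1" "x \<noteq> 1" for x
    unfolding character_via_class_sums [OF u0 x(1), symmetric]
    by (rule self_conjugate_valuation [OF q(1) w(1) z w(4,3) character_sum_mem [where a = a, OF z u0 p0 seq x(1)]
          nontrivial_character_norm [OF a p0 n(1) u(2) x] q(3)])
  obtain s where s: "\<not> u dvd s" "\<And>k. dvd_adj (z ^ u) (of_nat q ^ (r div 2)) (?B k - ?B (k + s))"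
    using shift_differences_dvd [OF p q(1,2) z u(1) class_sum_mem [where a = a, OF z u0 p0 seq] class_sum_mod X] by blast
  have "(\<Sum>k<u. ?B k * (z ^ p) ^ k) \<noteq> 0"
    by (rule nontrivial_character_neq_0 [OF a p0 n(1) u0 u(2) \<theta>u \<theta>1 n(2)])
  moreover have "(z ^ p) ^ s \<noteq> 1" unfolding primitive_root_power_eq_1_iff [OF \<theta>] by (rule s(1))
  ultimately obtain k where k: "?B k \<noteq> ?B (k + s)"
    using exists_shift_difference [of "z ^ p" u s ?B, OF \<theta>u _ class_sum_mod] by blast
  obtain b where b: "\<And>k. ?B k = (\<Sum>j<p. of_nat (b k j) * (z ^ u) ^ j)" "\<And>k. (\<Sum>j<p. b k j) = n div u"
    using class_sum_counts [where a = a, OF \<zeta> seq u0 u(2)] by blast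
  have diff: "?B k - ?B (k + s) = (\<Sum>j<p. of_int (int (b k j) - int (b (k + s) j)) * (z ^ u) ^ j)"
    by (rule class_sum_difference [OF b(1)])
  have "?B k - ?B (k + s) \<noteq> 0" using k by simp
  then show ?thesis
    using s(2) [of k] unfolding diff by (intro count_bound_other_prime [OF p q(1,2) \<zeta> b(2) b(2)])
qed

text \<open>As \<open>q\<close> divides neither \<open>u\<close> nor \<open>p\<close>, it is unramified in \<open>\<int>[z]\<close>.\<close>
lemma nontrivial_character_even:
  assumes a: "nearly_perfect_sequence p n \<gamma> a" and p: "prime p" and n: "n > 0"
    and q: "prime q" "q \<noteq> p" "exact_power_dvd q r (int n - \<gamma>)" and u: "u > 1" "u dvd n" "\<not> q dvd u"
    and sc: "self_conjugate_mod q (u * p)"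
  shows "even r"
proof -
  have p0: "p > 0" using prime_gt_0_nat [OF p] .
  have u0: "u > 0" using u by simp
  have seq: "a i ^ p = 1" for i
    using a unfolding nearly_perfect_sequence_def by (intro p_ary_entry_power [of p n]) simp
  obtain e w j where w: "u * p = q ^ e * w" "coprime q w" "j \<ge> 1" "w dvd q ^ j + 1"
    using self_conjugate_modE [OF q(1) _ sc] u0 p0 by auto
  have "\<not> q dvd u * p"
    using u(3) q p prime_dvd_mult_iff [OF q(1)] primes_dvd_imp_eq by blast
  then have "e = 0" unfolding w(1) by (cases e) auto
  then have v: "u * p dvd q ^ j + 1" using w by simp
  obtain z where z: "primitive_root_of_unity (u * p) z"
    using primitive_root_of_unity_exists [of "u * p"] u0 p0 by auto
  have z1: "z ^ (u * p) = 1" "u * p > 0" using z unfolding primitive_root_of_unity_def by auto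
  have \<theta>: "primitive_root_of_unity u (z ^ p)"
    using primitive_root_power [of p u z] z p0 by (simp add: mult.commute)
  have \<theta>u: "(z ^ p) ^ u = 1" using \<theta> unfolding primitive_root_of_unity_def by simp
  have \<theta>1: "z ^ p \<noteq> 1" using primitive_root_power_eq_1_iff [OF \<theta>, of 1] u by auto
  show ?thesis
    by (rule unramified_even [OF q(1) z1 v w(3) character_sum_mem [where a = a, OF z u0 p0 seq \<theta>u]
          nontrivial_character_norm [OF a p0 n u(2) \<theta>u \<theta>1] q(3)])
qed

text \<open>The sum of all entries lies in \<open>\<int>[\<zeta>]\<close> with \<open>\<zeta>\<close> of order \<open>p\<close>, where \<open>q\<close> is unramified, and self-conjugacy
  modulo \<open>u p\<close> is inherited by \<open>p\<close>.\<close>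
lemma trivial_character_even:
  assumes a: "nearly_perfect_sequence p n \<gamma> a" and p: "prime p" and n: "n > 0"
    and q: "prime q" "q \<noteq> p" "exact_power_dvd q r ((\<gamma> + 1) * int n - \<gamma>)" and u: "u > 0"
    and sc: "self_conjugate_mod q (u * p)"
  shows "even r"
proof -
  have p0: "p > 0" using prime_gt_0_nat [OF p] .
  have seq: "a i ^ p = 1" for i
    using a unfolding nearly_perfect_sequence_def by (intro p_ary_entry_power [of p n]) simp
  obtain e w j where w: "u * p = q ^ e * w" "coprime q w" "j \<ge> 1" "w dvd q ^ j + 1"
    using self_conjugate_modE [OF q(1) _ sc] u p0 by auto
  have "coprime p (q ^ e)" using primes_coprime [OF p q(1)] q(2) by simp
  moreover have "p dvd q ^ e * w" unfolding w(1) [symmetric] by simp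
  ultimately have "p dvd w" using coprime_dvd_mult_right_iff by blast
  then have v: "p dvd q ^ j + 1" using w(4) by (rule dvd_trans)
  obtain z where z: "primitive_root_of_unity (1 * p) z"
    using primitive_root_of_unity_exists [of "1 * p"] p0 by auto
  have z1: "z ^ p = 1" "p > 0" using z unfolding primitive_root_of_unity_def by auto
  have norm: "(\<Sum>i<n. a i * 1 ^ i) * cnj (\<Sum>i<n. a i * 1 ^ i) = of_int ((\<gamma> + 1) * int n - \<gamma>)"
    using character_norm [OF a p0 n, of 1] by simp
  have "(\<Sum>i<n. a i * 1 ^ i) \<in> int_adjoin z"
    by (rule character_sum_mem [where a = a, OF z _ p0 seq]) simp_all
  then show ?thesis by (rule unramified_even [OF q(1) z1 v w(3) _ norm q(3)])
qed

text \<open>Now \<open>p\<close> ramifies in \<open>\<int>[z]\<close> with \<open>\<pi> = 1 - z ^ u\<close>, where \<open>\<pi> ^ (p - 1)\<close> is associated to \<open>p\<close>; for odd \<open>r\<close> the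
  descent leaves the half power \<open>\<pi> ^ ((p - 1) div 2)\<close> besides \<open>p ^ (r div 2)\<close>.\<close>
lemma same_prime_bound:
  assumes a: "nearly_perfect_sequence p n \<gamma> a" and p: "prime p" and n: "n > 0" "int n - \<gamma> \<noteq> 0"
    and r: "exact_power_dvd p r (int n - \<gamma>)" and u: "u > 1" "u dvd n" "\<not> p dvd u"
    and sc: "self_conjugate_mod p u"
  shows "even r \<Longrightarrow> p ^ (r div 2) \<le> 2 * (n div u)"
    and "odd r \<Longrightarrow> p ^ ((r + 1) div 2) \<le> 4 * (n div u)"
proof -
  have p0: "p > 0" using prime_gt_0_nat [OF p] .
  have u0: "u > 0" using u by simp
  have N: "int p ^ r dvd int n - \<gamma>" using r unfolding exact_power_dvd_def by simp
  have seq: "a i ^ p = 1" for i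
    using a unfolding nearly_perfect_sequence_def by (intro p_ary_entry_power [of p n]) simp
  obtain e w j where w: "u = p ^ e * w" "coprime p w" "j \<ge> 1" "w dvd p ^ j + 1"
    using self_conjugate_modE [OF p u0 sc] .
  have "e = 0" using u(3) unfolding w(1) by (cases e) auto
  then have j: "u dvd p ^ j + 1" using w by simp
  have v: "u * p = p ^ Suc 0 * u" "u * p = p ^ 1 * u" by simp_all
  obtain z where z: "primitive_root_of_unity (u * p) z"
    using primitive_root_of_unity_exists [of "u * p"] u0 p0 by auto
  have z1: "z ^ (u * p) = 1" "u * p > 0" using z unfolding primitive_root_of_unity_def by auto
  have \<zeta>: "primitive_root_of_unity p (z ^ u)" using primitive_root_power [OF z u0] .
  have \<zeta>z: "z ^ u \<in> int_adjoin z" by (intro int_adjoin_power int_adjoin_generator)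
  have \<theta>: "primitive_root_of_unity u (z ^ p)"
    using primitive_root_power [of p u z] z p0 by (simp add: mult.commute)
  have \<theta>z: "z ^ p \<in> int_adjoin z" by (intro int_adjoin_power int_adjoin_generator)
  have \<theta>u: "(z ^ p) ^ u = 1" using \<theta> unfolding primitive_root_of_unity_def by simp
  have \<theta>1: "z ^ p \<noteq> 1" using primitive_root_power_eq_1_iff [OF \<theta>, of 1] u by auto
  let ?B = "class_sum a n u"
  let ?\<pi> = "1 - z ^ u"
  have \<pi>z: "?\<pi> \<in> int_adjoin z" by (intro int_adjoin_diff int_adjoin_1 \<zeta>z)
  have Bz: "?B k \<in> int_adjoin z" for k
    by (rule subsetD [OF int_adjoin_subset [OF \<zeta>z] class_sum_mem [where a = a, OF z u0 p0 seq]])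
  have cop: "coprime u p" using prime_imp_coprime [OF p u(3)] by (simp add: coprime_commute)
  have "(\<Sum>k<u. ?B k * (z ^ p) ^ k) \<noteq> 0"
    by (rule nontrivial_character_neq_0 [OF a p0 n(1) u0 u(2) \<theta>u \<theta>1 n(2)])
  moreover have "(z ^ p) ^ 1 \<noteq> 1" using \<theta>1 by simp
  ultimately obtain k where k: "?B k \<noteq> ?B (k + 1)"
    using exists_shift_difference [of "z ^ p" u 1 ?B, OF \<theta>u _ class_sum_mod] by blast
  obtain b where b: "\<And>k. ?B k = (\<Sum>j<p. of_nat (b k j) * (z ^ u) ^ j)" "\<And>k. (\<Sum>j<p. b k j) = n div u"
    using class_sum_counts [where a = a, OF \<zeta> seq u0 u(2)] by blast
  have diff: "?B k - ?B (k + 1) = (\<Sum>j<p. of_int (int (b k j) - int (b (k + 1) j)) * (z ^ u) ^ j)"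
    by (rule class_sum_difference [OF b(1)])
  have nz: "(\<Sum>j<p. of_int (int (b k j) - int (b (k + 1) j)) * (z ^ u) ^ j) \<noteq> 0"
    unfolding diff [symmetric] using k by simp
  have D: "dvd_adj z c (\<Sum>j<p. of_int (int (b k j) - int (b (k + 1) j)) * (z ^ u) ^ j)"
    if c: "dvd_adj z c (of_nat p ^ t)"
      and X: "\<And>x. x ^ u = 1 \<Longrightarrow> x \<noteq> 1 \<Longrightarrow> dvd_adj z c (\<Sum>i<n. a i * x ^ i)" for c t
  proof -
    have "dvd_adj z c (?B (k mod u) - ?B ((k + 1) mod u))"
    proof (rule class_differences_dvd_coprime [OF z1 \<theta> \<theta>z Bz cop c])
      fix x :: complex assume x: "x ^ u = 1" "x \<noteq> 1"
      show "dvd_adj z c (\<Sum>k<u. ?B k * x ^ k)"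
        unfolding character_via_class_sums [OF u0 x(1), symmetric] by (rule X [OF x])
    qed (use u in simp_all)
    then show ?thesis unfolding class_sum_mod diff .
  qed
  have Xmem: "(\<Sum>i<n. a i * x ^ i) \<in> int_adjoin z" if "x ^ u = 1" for x
    by (rule character_sum_mem [where a = a, OF z u0 p0 seq that])
  have Xnorm: "(\<Sum>i<n. a i * x ^ i) * cnj (\<Sum>i<n. a i * x ^ i) = of_int (int n - \<gamma>)"
    if "x ^ u = 1" "x \<noteq> 1" for x
    by (rule nontrivial_character_norm [OF a p0 n(1) u(2) that])
  have Xval: "dvd_adj z (?\<pi> ^ (((p - 1) * r + 1) div 2)) (\<Sum>i<n. a i * x ^ i)"
    if "x ^ u = 1" "x \<noteq> 1" for x
    using ramified_valuation [OF p v(1) z j w(3) Xmem [OF that(1)] Xnorm [OF that] N] by simp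
  show "p ^ (r div 2) \<le> 2 * (n div u)" if "even r"
  proof (rule count_bound_same_prime_even [OF p \<zeta> \<zeta>z z1 b(2) b(2) D [OF dvd_adj_refl] nz])
    fix x :: complex assume x: "x ^ u = 1" "x \<noteq> 1"
    show "dvd_adj z (of_nat p ^ (r div 2)) (\<Sum>i<n. a i * x ^ i)"
      by (rule self_conjugate_valuation [OF p v(2) z j w(3) Xmem [OF x(1)] Xnorm [OF x] N])
  qed
  show "p ^ ((r + 1) div 2) \<le> 4 * (n div u)" if r_odd: "odd r"
  proof -
    define t where "t = r div 2"
    have t: "r = 2 * t + 1" using r_odd by (simp add: t_def)
    have "odd p"
    proof
      \<comment> \<open>for \<open>p = 2\<close> one has \<open>\<pi> = 2\<close>, so \<open>2\<close> behaves as in the unramified case and \<open>r\<close> cannot be odd\<close>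
      assume "even p"
      then have p2: "p = 2" using p primes_dvd_imp_eq two_is_prime_nat by blast
      have "(z ^ u) ^ 2 = 1" "z ^ u \<noteq> 1"
        using \<zeta> primitive_root_power_eq_1_iff [OF \<zeta>, of 1] unfolding p2 primitive_root_of_unity_def by auto
      then have "z ^ u = -1" by (simp add: power2_eq_1_iff)
      then have "dvd_adj z (of_nat p ^ (t + 1)) (\<Sum>i<n. a i * (z ^ p) ^ i)"
        using Xval [OF \<theta>u \<theta>1] by (simp add: p2 t)
      then have "int p ^ (2 * (t + 1)) dvd int n - \<gamma>"
        by (rule dvd_norm_from_dvd_adj [OF p z1 Xnorm [OF \<theta>u \<theta>1]])
      then show False using r unfolding exact_power_dvd_def by (simp add: t)
    qed
    then have half: "2 * ((p - 1) div 2) = p - 1" by simp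
    have \<zeta>': "primitive_root_of_unity (p ^ Suc 0) (z ^ u)" using \<zeta> by simp
    have p_pi: "dvd_adj z (of_nat p) (?\<pi> ^ (p - 1))" and pi_p: "dvd_adj z (?\<pi> ^ (p - 1)) (of_nat p)"
      using prime_associated_power [OF p \<zeta>'] dvd_adj_subset [OF _ \<zeta>z] by auto
    let ?c = "of_nat p ^ t * ?\<pi> ^ ((p - 1) div 2)"
    have "dvd_adj z (?\<pi> ^ ((p - 1) div 2)) (?\<pi> ^ (p - 1))" by (rule dvd_adj_power_le [OF \<pi>z]) simp
    then have "dvd_adj z ?c (of_nat p ^ t * of_nat p)"
      by (intro dvd_adj_mult_mono dvd_adj_refl dvd_adj_trans [OF _ pi_p])
    then have c: "dvd_adj z ?c (of_nat p ^ (t + 1))" by (simp add: mult.commute)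
    have "dvd_adj z ?c (\<Sum>i<n. a i * x ^ i)" if x: "x ^ u = 1" "x \<noteq> 1" for x
    proof -
      have "((p - 1) * r + 1) div 2 = (p - 1) * t + (p - 1) div 2"
      proof -
        have "(p - 1) * r + 1 = 2 * ((p - 1) * t + (p - 1) div 2) + 1"
          using half by (simp add: t algebra_simps)
        then show ?thesis by simp
      qed
      then have "?\<pi> ^ (((p - 1) * r + 1) div 2) = (?\<pi> ^ (p - 1)) ^ t * ?\<pi> ^ ((p - 1) div 2)"
        by (simp add: power_add power_mult)
      moreover have "dvd_adj z ?c ((?\<pi> ^ (p - 1)) ^ t * ?\<pi> ^ ((p - 1) div 2))"
        by (intro dvd_adj_mult_mono dvd_adj_power_mono p_pi dvd_adj_refl)
      ultimately show ?thesis using dvd_adj_trans [OF _ Xval [OF x]] by simp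
    qed
    then have "p ^ (t + 1) \<le> 4 * (n div u)"
      by (intro count_bound_same_prime_odd [OF p \<open>odd p\<close> \<zeta> \<zeta>z z1 b(2) b(2) D [OF c] nz])
    then show ?thesis by (simp add: t)
  qed
qed

section \<open>Nonexistence conditions for nearly perfect sequences\<close>

theorem theorem2:
  fixes p n :: nat and \<gamma> :: int
  assumes "prime p" and "n \<ge> 1" and "\<bar>\<gamma>\<bar> < int n" and "int p dvd int n - \<gamma>"
    and "\<exists>a. nearly_perfect_sequence p n \<gamma> a"
  shows
    "(\<gamma> = 0 \<longrightarrow>
       (\<forall>q r u :: nat.
          prime q \<and> q \<noteq> p \<and> q dvd n \<and> exact_power_dvd q r (int n) \<and>
          u \<ge> 1 \<and> u dvd n \<and> self_conjugate_mod q (u * p) \<longrightarrow>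
          even r \<and> real q ^ (r div 2) \<le> real n / real u)) \<and>
     (\<gamma> \<noteq> 0 \<longrightarrow>
       (\<forall>q r u :: nat.
          prime q \<and> q \<noteq> p \<and> int q dvd int n - \<gamma> \<and> exact_power_dvd q r (int n - \<gamma>) \<and>
          u > 1 \<and> u dvd n \<and> self_conjugate_mod q (u * p) \<longrightarrow>
          (\<not> q dvd u \<longrightarrow> even r \<and> real q ^ (r div 2) \<le> real n / real u) \<and>
          (q dvd u \<longrightarrow> real q ^ (r div 2) \<le> 2 * (real n / real u)))) \<and>
     (\<gamma> \<noteq> 0 \<longrightarrow>
       (\<forall>r u :: nat.
          exact_power_dvd p r (int n - \<gamma>) \<and>
          u > 1 \<and> u dvd n \<and> \<not> p dvd u \<and> self_conjugate_mod p u \<longrightarrow>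
          (even r \<longrightarrow> real p ^ (r div 2) \<le> 2 * (real n / real u)) \<and>
          (odd r \<longrightarrow> real p ^ ((r + 1) div 2) \<le> 4 * (real n / real u)))) \<and>
     (\<gamma> \<noteq> 0 \<longrightarrow>
       (\<forall>q r u :: nat.
          prime q \<and> q \<noteq> p \<and> int q dvd (\<gamma> + 1) * int n - \<gamma> \<and>
          exact_power_dvd q r ((\<gamma> + 1) * int n - \<gamma>) \<and>
          u \<ge> 1 \<and> u dvd n \<and> self_conjugate_mod q (u * p) \<longrightarrow>
          (\<not> q dvd u \<longrightarrow> even r)))"
proof -
  note p = assms(1)
  have n: "n > 0" "int n - \<gamma> \<noteq> 0" using assms(2,3) by auto
  obtain a where a: "nearly_perfect_sequence p n \<gamma> a" using assms(5) by blast
  have real_bound: "real x \<le> real c * (real n / real u)" if "x \<le> c * (n div u)" "u dvd n" for x c u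
  proof -
    have "real x \<le> real (c * (n div u))" using that(1) by (simp only: of_nat_le_iff)
    then show ?thesis using that(2) by (simp add: real_of_nat_div)
  qed
  have bound: "real q ^ (r div 2) \<le> real n / real u"
    if "prime q" "q \<noteq> p" "exact_power_dvd q r (int n - \<gamma>)" "u > 1" "u dvd n" "self_conjugate_mod q (u * p)"
    for q r u
  proof -
    have "int q ^ r dvd int n - \<gamma>" using that(3) unfolding exact_power_dvd_def by simp
    from other_prime_bound [OF a p n that(1,2) this that(4-6)]
    show ?thesis using real_bound [of "q ^ (r div 2)" 1 u] that(5) by simp
  qed
  show ?thesis
  proof (intro conjI impI allI; (elim conjE)?)
    fix q r u :: nat
    assume "\<gamma> = 0" and h: "prime q" "q \<noteq> p" "exact_power_dvd q r (int n)" "u \<ge> 1" "u dvd n"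
      "self_conjugate_mod q (u * p)"
    have "exact_power_dvd q r ((\<gamma> + 1) * int n - \<gamma>)" using h(3) \<open>\<gamma> = 0\<close> by simp
    then show "even r" using h(4) by (intro trivial_character_even [OF a p n(1) h(1,2) _ _ h(6)]) simp_all
    show "real q ^ (r div 2) \<le> real n / real u"
    \<comment> \<open>for \<open>u = 1\<close> there is no nontrivial character, but \<open>q ^ r\<close> divides \<open>n\<close>\<close>
    proof (cases "u = 1")
      case True
      have "int (q ^ r) dvd int n" using h(3) unfolding exact_power_dvd_def by simp
      then have "q ^ r \<le> n" using n(1) by (simp only: of_nat_dvd_iff dvd_imp_le)
      moreover have "q ^ (r div 2) \<le> q ^ r"
        using prime_gt_0_nat [OF h(1)] by (intro power_increasing) simp_all
      ultimately have "real (q ^ (r div 2)) \<le> real n" by (simp only: of_nat_le_iff le_trans)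
      then show ?thesis using True by simp
    next
      case False
      then show ?thesis using bound [OF h(1,2) _ _ h(5,6)] h(3,4) \<open>\<gamma> = 0\<close> by simp
    qed
  next
    fix q r u :: nat
    assume h: "prime q" "q \<noteq> p" "exact_power_dvd q r (int n - \<gamma>)" "u > 1" "u dvd n"
      "self_conjugate_mod q (u * p)"
    show "even r" if "\<not> q dvd u"
      by (rule nontrivial_character_even [OF a p n(1) h(1-5) that h(6)])
    show "real q ^ (r div 2) \<le> real n / real u" by (rule bound [OF h])
    have "0 \<le> real n / real u" by simp
    then show "real q ^ (r div 2) \<le> 2 * (real n / real u)" using bound [OF h] by linarith
  next
    fix r u :: nat
    assume h: "exact_power_dvd p r (int n - \<gamma>)" "u > 1" "u dvd n" "\<not> p dvd u" "self_conjugate_mod p u"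
    show "real p ^ (r div 2) \<le> 2 * (real n / real u)" if "even r"
      using real_bound [OF same_prime_bound(1) [OF a p n h that] h(3)] by simp
    show "real p ^ ((r + 1) div 2) \<le> 4 * (real n / real u)" if "odd r"
      using real_bound [OF same_prime_bound(2) [OF a p n h that] h(3)] by simp
  next
    fix q r u :: nat
    assume h: "prime q" "q \<noteq> p" "exact_power_dvd q r ((\<gamma> + 1) * int n - \<gamma>)" "u \<ge> 1"
      "self_conjugate_mod q (u * p)"
    then show "even r" by (intro trivial_character_even [OF a p n(1) h(1-3) _ h(5)]) simp
  qed
qed

end
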